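(* (Rational soliton solution.) Suppose that $\kappa_1$ is a repeated real root of the characteristic equation $$(\kappa/z_1-2)(\kappa+b_1)+(a_1^2+\sigma a_2^2)b_1^2=0\qquad(\text{case } b_1=b_2)$$ or of the characteristic equation $$(\kappa/z_1-2)(\kappa+b_1)(\kappa+b_2)+a_1^2b_1^2(\kappa+b_2)+\sigma a_2^2b_2^2(\kappa+b_1)=0\qquad(\text{case } b_1\ne b_2,\ a_2\neq0).$$ Then, choosing the appropriate parameter $\varsigma_1$ in the dark/anti-dark soliton formula of the context, one obtains through a limit the following rational solution of the coupled Fokas–Lenells equation: $$u_s[1]=a_s\left[\frac{2\kappa_1\Big(x+\frac{1}{b_1b_2z_1}\big[\kappa_1-z_1+\frac{b_1+b_2}{2}\big]t\Big)+\mathrm i\,\frac{\kappa_1-b_s}{\kappa_1+b_s}}{2\kappa_1\Big(x+\frac{1}{b_1b_2z_1}\big[\kappa_1-z_1+\frac{b_1+b_2}{2}\big]t\Big)+\mathrm i}\right]\mathrm e^{\mathrm i\omega_s},\qquad s=1,2.$$ The peak values of $|u_s[1]|^2$ are $a_s^2\frac{(\kappa_1-b_s)^2}{(\kappa_1+b_s)^2}$. This rational solution is a soliton solution, not a rogue wave solution.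
   Context: Coupled Fokas–Lenells equation ($\sigma=\pm1$): $u_{1,xt}+u_1+\mathrm i(|u_1|^2+\tfrac12\sigma|u_2|^2)u_{1,x}+\tfrac{\mathrm i}{2}\sigma u_1u_2^*u_{2,x}=0$, $u_{2,xt}+u_2+\mathrm i(\sigma|u_2|^2+\tfrac12|u_1|^2)u_{2,x}+\tfrac{\mathrm i}{2}u_2u_1^*u_{1,x}=0$. Here $a_1,a_2$ are real with $a_1\neq0$, $b_1,b_2$ are nonzero reals, and $z_1=\lambda_1^{-2}$ with $\lambda_1\in\mathbb R\cup\mathrm i\mathbb R$. The phases are $\omega_1=b_1x-\frac12\big(2a_1^2+\sigma a_2^2-\frac{2}{b_1}+\sigma a_2^2\frac{b_2}{b_1}\big)t$ and $\omega_2=b_2x-\frac12\big(2\sigma a_2^2+a_1^2-\frac{2}{b_2}+a_1^2\frac{b_1}{b_2}\big)t$. Dark/anti-dark soliton formula: for $\kappa_1$ one of a pair of conjugate complex roots of the characteristic equation, $$u_s[1]=a_s\left[\frac{\kappa_1\exp(\vartheta_1+\vartheta_1^*+\mathrm i\tau_s)+\varsigma_1|\kappa_1|}{\kappa_1^*\exp(\vartheta_1+\vartheta_1^* )+\varsigma_1|\kappa_1|}\right]\mathrm e^{\mathrm i\omega_s},\qquad \exp(\mathrm i\tau_s)=\frac{\kappa_1^*+b_s}{\kappa_1+b_s},\quad \varsigma_1=\pm1,$$ with $\vartheta_1=\mathrm i(\kappa_1-z_1)\big(x+\frac{1}{2b_1b_2z_1}(\kappa_1-z_1+b_1+b_2)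t\big)$.
   Formalization: The formal statement assumes κ₁+b_s≠0 (needed for the formula to be defined), and claims "is a soliton solution" only for κ₁≠0 and components with a_s≠0; for κ₁=0 the formula is a plane wave of constant modulus, and for a₂=0 the second component vanishes. *)

theory Defs
  imports "HOL-Analysis.Analysis" "HOL-Computational_Algebra.Polynomial"
begin

text \<open>
  Fields and parameter vectors are indexed by \<open>s \<in> {1, 2}\<close>, encoded as natural numbers: \<open>a s\<close>, \<open>b s\<close> and
  \<open>u s x t\<close>. Values at other indices are irrelevant.
\<close>

text \<open>The functions \<open>p s\<close> and \<open>q s\<close> are the derivatives $u_{s,x}$ and $u_{s,xt}$, required to exist on the whole plane.\<close>

definition coupled_FL_solution :: "real \<Rightarrow> (nat \<Rightarrow> real \<Rightarrow> real \<Rightarrow> complex) \<Rightarrow> bool" where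
  "coupled_FL_solution \<sigma> u \<longleftrightarrow>
    (\<exists>p q. \<forall>x t.
      (\<forall>s\<in>{1,2}.
        ((\<lambda>x'. u s x' t) has_vector_derivative p s x t) (at x) \<and>
        ((\<lambda>t'. p s x t') has_vector_derivative q s x t) (at t)) \<and>
      q 1 x t + u 1 x t
        + \<i> * of_real ((cmod (u 1 x t))\<^sup>2 + \<sigma> / 2 * (cmod (u 2 x t))\<^sup>2) * p 1 x t
        + \<i> / 2 * of_real \<sigma> * u 1 x t * cnj (u 2 x t) * p 2 x t = 0 \<and>
      q 2 x t + u 2 x t
        + \<i> * of_real (\<sigma> * (cmod (u 2 x t))\<^sup>2 + 1 / 2 * (cmod (u 1 x t))\<^sup>2) * p 2 x t
        + \<i> / 2 * u 2 x t * cnj (u 1 x t) * p 1 x t = 0)"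

text \<open>
  The nonzero reals of the form $\lambda^{-2}$ with $\lambda$ real or purely imaginary.
\<close>

definition spectral_value :: "real \<Rightarrow> bool" where
  "spectral_value z \<longleftrightarrow>
    (\<exists>l::complex. l \<noteq> 0 \<and> (l \<in> \<real> \<or> (\<exists>r::real. l = \<i> * of_real r)) \<and> of_real z = inverse (l\<^sup>2))"

text \<open>The last disjunction describes the two cases in which a characteristic equation is given.\<close>

definition admissible :: "(nat \<Rightarrow> real) \<Rightarrow> (nat \<Rightarrow> real) \<Rightarrow> real \<Rightarrow> bool" where
  "admissible a b z \<longleftrightarrow>
    a 1 \<noteq> 0 \<and> b 1 \<noteq> 0 \<and> b 2 \<noteq> 0 \<and> spectral_value z \<and> (b 1 = b 2 \<or> a 2 \<noteq> 0)"

definition characteristic_poly ::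
  "real \<Rightarrow> (nat \<Rightarrow> real) \<Rightarrow> (nat \<Rightarrow> real) \<Rightarrow> real \<Rightarrow> real poly" where
  "characteristic_poly \<sigma> a b z =
    (if b 1 = b 2
     then [:-2, 1 / z:] * [:b 1, 1:] + [:((a 1)\<^sup>2 + \<sigma> * (a 2)\<^sup>2) * (b 1)\<^sup>2:]
     else [:-2, 1 / z:] * [:b 1, 1:] * [:b 2, 1:]
       + smult ((a 1)\<^sup>2 * (b 1)\<^sup>2) [:b 2, 1:] + smult (\<sigma> * (a 2)\<^sup>2 * (b 2)\<^sup>2) [:b 1, 1:])"

definition phase ::
  "real \<Rightarrow> (nat \<Rightarrow> real) \<Rightarrow> (nat \<Rightarrow> real) \<Rightarrow> nat \<Rightarrow> real \<Rightarrow> real \<Rightarrow> real" where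
  "phase \<sigma> a b s x t =
    (if s = 1
     then b 1 * x - 1 / 2 * (2 * (a 1)\<^sup>2 + \<sigma> * (a 2)\<^sup>2 - 2 / b 1 + \<sigma> * (a 2)\<^sup>2 * (b 2 / b 1)) * t
     else b 2 * x - 1 / 2 * (2 * \<sigma> * (a 2)\<^sup>2 + (a 1)\<^sup>2 - 2 / b 2 + (a 1)\<^sup>2 * (b 1 / b 2)) * t)"

definition theta :: "(nat \<Rightarrow> real) \<Rightarrow> real \<Rightarrow> complex \<Rightarrow> real \<Rightarrow> real \<Rightarrow> complex" where
  "theta b z k x t =
    \<i> * (k - of_real z)
      * (of_real x + 1 / of_real (2 * b 1 * b 2 * z) * (k - of_real z + of_real (b 1 + b 2)) * of_real t)"

text \<open>
  The phase shift $\tau_s$ enters only through $\exp(\mathrm{i}\tau_s) = (k^* + b_s)/(k + b_s)$,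
  which is inserted directly. The sign $\varsigma_1$ is \<open>\<epsilon>\<close>.
\<close>

definition dark_soliton ::
  "real \<Rightarrow> (nat \<Rightarrow> real) \<Rightarrow> (nat \<Rightarrow> real) \<Rightarrow> real \<Rightarrow> real \<Rightarrow> complex \<Rightarrow> nat \<Rightarrow> real \<Rightarrow> real \<Rightarrow> complex" where
  "dark_soliton \<sigma> a b z \<epsilon> k s x t =
    (let e = exp (theta b z k x t + cnj (theta b z k x t));
         ph = (cnj k + of_real (b s)) / (k + of_real (b s))
     in of_real (a s)
        * ((k * (e * ph) + of_real (\<epsilon> * cmod k)) / (cnj k * e + of_real (\<epsilon> * cmod k)))
        * exp (\<i> * of_real (phase \<sigma> a b s x t)))"

definition rational_soliton ::
  "real \<Rightarrow> (nat \<Rightarrow> real) \<Rightarrow> (nat \<Rightarrow> real) \<Rightarrow> real \<Rightarrow> real \<Rightarrow> nat \<Rightarrow> real \<Rightarrow> real \<Rightarrow> complex" where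
  "rational_soliton \<sigma> a b z \<kappa> s x t =
    (let y = 2 * \<kappa> * (x + 1 / (b 1 * b 2 * z) * (\<kappa> - z + (b 1 + b 2) / 2) * t)
     in of_real (a s)
        * ((of_real y + \<i> * of_real ((\<kappa> - b s) / (\<kappa> + b s))) / (of_real y + \<i>))
        * exp (\<i> * of_real (phase \<sigma> a b s x t)))"

text \<open>
  Dark/anti-dark soliton data (admissible parameters with a non-real root of their own
  characteristic equation) that tend to the data of the degenerate case.
\<close>

definition soliton_data_tendsto ::
  "real \<Rightarrow> (nat \<Rightarrow> nat \<Rightarrow> real) \<Rightarrow> (nat \<Rightarrow> nat \<Rightarrow> real) \<Rightarrow> (nat \<Rightarrow> real) \<Rightarrow> (nat \<Rightarrow> complex)
    \<Rightarrow> (nat \<Rightarrow> real) \<Rightarrow> (nat \<Rightarrow> real) \<Rightarrow> real \<Rightarrow> real \<Rightarrow> bool" where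
  "soliton_data_tendsto \<sigma> A B Z K a b z \<kappa> \<longleftrightarrow>
    (\<forall>n. admissible (A n) (B n) (Z n) \<and> K n \<notin> \<real> \<and>
      poly (map_poly of_real (characteristic_poly \<sigma> (A n) (B n) (Z n))) (K n) = 0) \<and>
    (\<forall>s\<in>{1,2}. (\<lambda>n. A n s) \<longlonglongrightarrow> a s \<and> (\<lambda>n. B n s) \<longlonglongrightarrow> b s) \<and>
    Z \<longlonglongrightarrow> z \<and> K \<longlonglongrightarrow> of_real \<kappa>"

text \<open>
  A peak value is an attained global extremum of the intensity: a maximum for an anti-dark
  soliton, a minimum for a dark one.
\<close>

definition peak_values :: "(real \<Rightarrow> real \<Rightarrow> real) \<Rightarrow> real set" where
  "peak_values f = {v. \<exists>x t. f x t = v \<and> ((\<forall>x' t'. f x' t' \<le> v) \<or> (\<forall>x' t'. v \<le> f x' t'))}"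

text \<open>
  On the background of amplitude \<open>\<bar>a\<bar>\<close>, a soliton has an intensity that moves with constant
  velocity \<open>v\<close> and unchanged, nontrivial, localized profile \<open>G\<close>; a rogue wave is a nontrivial
  perturbation that is localized in space and time simultaneously.
\<close>

definition soliton_profile :: "real \<Rightarrow> real \<Rightarrow> (real \<Rightarrow> real \<Rightarrow> complex) \<Rightarrow> bool" where
  "soliton_profile v a w \<longleftrightarrow>
    (\<exists>G. (\<forall>x t. (cmod (w x t))\<^sup>2 = G (x - v * t)) \<and>
      (G \<longlongrightarrow> a\<^sup>2) at_top \<and> (G \<longlongrightarrow> a\<^sup>2) at_bot \<and> (\<exists>\<xi>. G \<xi> \<noteq> a\<^sup>2))"

definition rogue_wave_profile :: "real \<Rightarrow> (real \<Rightarrow> real \<Rightarrow> complex) \<Rightarrow> bool" where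
  "rogue_wave_profile a w \<longleftrightarrow>
    (\<exists>x t. cmod (w x t) \<noteq> \<bar>a\<bar>) \<and> ((\<lambda>(x, t). cmod (w x t)) \<longlongrightarrow> \<bar>a\<bar>) at_infinity"

end

(* The rational solution is u_s = a_s (1 - i rho_s h) exp(i omega_s) with rho_s = 2 b_s / (kappa + b_s) and
   h = 1 / (y + i), where y is affine in x and t. A double root of the characteristic equation means
     sum_s A_s b_s^2 / (kappa + b_s)^2 = 1 / z   and   kappa / z - 2 + sum_s A_s b_s^2 / (kappa + b_s) = 0
   with A_1 = a_1^2, A_2 = sigma a_2^2, in both cases b_1 = b_2 and b_1 <> b_2; these two relations make the
   rational ansatz a solution.

   In the dark soliton formula, with k a non-real root near kappa and the sign opposite to that of kappa,
   numerator and denominator are both of order Im k; dividing by Im k gives the rational formula in the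
   limit.

   Since |u_s|^2 = a_s^2 (1 + (r_s^2 - 1) / (y^2 + 1)) with r_s = (kappa - b_s) / (kappa + b_s), the extremal
   values and the travelling profile are explicit; along the line y = 0 the intensity does not decay to the
   background, which excludes a rogue wave. *)
theory Submission
  imports Defs "HOL-Real_Asymp.Real_Asymp"
begin

section \<open>Spectral values and the double root relations\<close>

text \<open>Real \<open>l\<close> produces the positive values and imaginary \<open>l\<close> the
  negative ones, so the spectral condition amounts to being able to divide by
  \<open>z\<close>.\<close>

lemma spectral_value_iff: "spectral_value z \<longleftrightarrow> z \<noteq> 0"
proof
  assume "spectral_value z"
  then show "z \<noteq> 0" by (auto simp: spectral_value_def)
next
  assume z: "z \<noteq> 0"
  show "spectral_value z"
  proof (cases "z > 0")
    case True
    have "of_real z = inverse ((complex_of_real (1 / sqrt z))\<^sup>2)"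
      using True by (simp flip: of_real_power add: power_divide)
    with True show ?thesis
      unfolding spectral_value_def by (intro exI[of _ "complex_of_real (1 / sqrt z)"]) simp
  next
    case False
    then have "of_real z = inverse ((\<i> * complex_of_real (1 / sqrt (- z)))\<^sup>2)"
      by (simp flip: of_real_power add: power_divide power_mult_distrib)
    with False z show ?thesis
      unfolding spectral_value_def
      by (intro exI[of _ "\<i> * complex_of_real (1 / sqrt (- z))"] conjI disjI2 exI[of _ "1 / sqrt (- z)"]) simp_all
  qed
qed

lemma order_ge_2_imp_roots:
  fixes P :: "real poly"
  assumes "order c P \<ge> 2"
  shows "poly P c = 0" "poly (pderiv P) c = 0"
proof -
  obtain Q where P: "P = [:-c, 1:]\<^sup>2 * Q"
    using assms order_divides by blast
  show "poly P c = 0" "poly (pderiv P) c = 0"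
    unfolding P power2_eq_square pderiv_mult poly_mult poly_add by simp_all
qed

text \<open>Let \<open>F\<close> be the left-hand side of the second identity as a function of
  \<open>\<kappa>\<close>. The characteristic polynomial is \<open>F\<close> times
  \<open>\<kappa> + b 1\<close> if \<open>b 1 = b 2\<close>, and \<open>F\<close> times both factors
  \<open>\<kappa> + b s\<close> otherwise. Where these factors do not vanish, a double root of the
  polynomial is a double root of \<open>F\<close>, and the two identities say that the derivative of
  \<open>F\<close> and \<open>F\<close> itself vanish.\<close>

lemma double_root_identities:
  assumes "admissible a b z" "order \<kappa> (characteristic_poly \<sigma> a b z) \<ge> 2"
    and n1: "\<kappa> + b 1 \<noteq> 0" and n2: "\<kappa> + b 2 \<noteq> 0"
  shows "(a 1)\<^sup>2 * (b 1)\<^sup>2 / (\<kappa> + b 1)\<^sup>2 + \<sigma> * (a 2)\<^sup>2 * (b 2)\<^sup>2 / (\<kappa> + b 2)\<^sup>2 = 1 / z"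
    and "\<kappa> / z - 2 + (a 1)\<^sup>2 * (b 1)\<^sup>2 / (\<kappa> + b 1) + \<sigma> * (a 2)\<^sup>2 * (b 2)\<^sup>2 / (\<kappa> + b 2) = 0"
proof -
  let ?A = "(a 1)\<^sup>2 * (b 1)\<^sup>2" and ?B = "\<sigma> * (a 2)\<^sup>2 * (b 2)\<^sup>2"
  note roots = order_ge_2_imp_roots[OF assms(2)]
  have "?A / (\<kappa> + b 1)\<^sup>2 + ?B / (\<kappa> + b 2)\<^sup>2 = 1 / z \<and> \<kappa> / z - 2 + ?A / (\<kappa> + b 1) + ?B / (\<kappa> + b 2) = 0"
  proof (cases "b 1 = b 2")
    case True
    define C where "C = ((a 1)\<^sup>2 + \<sigma> * (a 2)\<^sup>2) * (b 1)\<^sup>2"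
    define w where "w = 1 / z"
    define d where "d = \<kappa> + b 1"
    have P: "(\<kappa> * w - 2) * d + C = 0" "w * d + (\<kappa> * w - 2) = 0"
      using roots True
      by (simp_all add: characteristic_poly_def pderiv_pCons pderiv_mult C_def w_def d_def algebra_simps)
    have d: "d \<noteq> 0" using n1 by (simp add: d_def)
    have "C = w * d\<^sup>2" using P by algebra
    then have C: "C / d\<^sup>2 = w" "C / d = w * d"
      using d by (simp_all add: power2_eq_square)
    have "?A / d\<^sup>2 + ?B / d\<^sup>2 = C / d\<^sup>2" "?A / d + ?B / d = C / d"
      using True by (simp_all add: C_def add_divide_distrib[symmetric] algebra_simps)
    with C P(2) True show ?thesis by (simp add: w_def d_def)
  next
    case False
    define w where "w = 1 / z"
    define d where "d = \<kappa> + b 1"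
    define e where "e = \<kappa> + b 2"
    have d: "d \<noteq> 0" and e: "e \<noteq> 0" using n1 n2 by (simp_all add: d_def e_def)
    have "characteristic_poly \<sigma> a b z = [:-2, w:] * [:b 1, 1:] * [:b 2, 1:]
        + smult ?A [:b 2, 1:] + smult ?B [:b 1, 1:]"
      using False by (simp only: characteristic_poly_def w_def if_False)
    then have P: "(\<kappa> * w - 2) * d * e + ?A * e + ?B * d = 0"
      "w * d * e + (\<kappa> * w - 2) * e + (\<kappa> * w - 2) * d + ?A + ?B = 0"
      using roots
      by (simp_all add: pderiv_pCons pderiv_mult pderiv_add pderiv_smult d_def e_def algebra_simps)
    \<comment> \<open>This is \<open>d * e\<close> times the second relation in \<open>P\<close>
      minus \<open>d + e\<close> times the first.\<close>
    have "w * d\<^sup>2 * e\<^sup>2 = ?A * e\<^sup>2 + ?B * d\<^sup>2" using P by algebra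
    then have "?A / d\<^sup>2 + ?B / e\<^sup>2 = w" using d e by (simp add: field_simps)
    moreover have "\<kappa> * w - 2 + ?A / d + ?B / e = 0" using P(1) d e by (simp add: field_simps)
    ultimately show ?thesis by (simp add: w_def d_def e_def)
  qed
  then show "?A / (\<kappa> + b 1)\<^sup>2 + ?B / (\<kappa> + b 2)\<^sup>2 = 1 / z" "\<kappa> / z - 2 + ?A / (\<kappa> + b 1) + ?B / (\<kappa> + b 2) = 0"
    by auto
qed

section \<open>Verification of the rational ansatz\<close>

text \<open>One rule serves both differentiations: the ansatz as a function of \<open>x\<close>,
  with \<open>c2 = 0\<close>, and its \<open>x\<close> derivative as a function of \<open>t\<close>,
  where the term with \<open>c2\<close> appears.\<close>

lemma has_vector_derivative_exp_Laurent:
  fixes \<alpha> \<beta> \<gamma> \<delta> x :: real and C c0 c1 c2 :: complex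
  defines "D \<equiv> \<lambda>x. complex_of_real (\<alpha> * x + \<beta>) + \<i>"
  defines "L \<equiv> \<lambda>x. c0 + c1 / D x + c2 / (D x)\<^sup>2"
  defines "E \<equiv> \<lambda>x. exp (\<i> * complex_of_real (\<gamma> * x + \<delta>))"
  shows "((\<lambda>x. C * L x * E x) has_vector_derivative
    C * (\<i> * of_real \<gamma> * L x - of_real \<alpha> * (c1 / (D x)\<^sup>2 + 2 * c2 / (D x)^3)) * E x) (at x)"
proof -
  have D: "of_real \<alpha> * of_real x + of_real \<beta> + \<i> \<noteq> 0"
    by (simp add: complex_eq_iff)
  \<comment> \<open>The derivative is computed for a complex variable, where the field rules apply,
    and then restricted to the real line.\<close>
  have "((\<lambda>\<xi>. C * (c0 + c1 / (of_real \<alpha> * \<xi> + of_real \<beta> + \<i>) + c2 / (of_real \<alpha> * \<xi> + of_real \<beta> + \<i>)\<^sup>2)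
          * exp (\<i> * (of_real \<gamma> * \<xi> + of_real \<delta>))) has_field_derivative
    C * (\<i> * of_real \<gamma> * L x - of_real \<alpha> * (c1 / (D x)\<^sup>2 + 2 * c2 / (D x)^3)) * E x) (at (of_real x))"
    unfolding L_def D_def E_def of_real_add of_real_mult
    apply (rule derivative_eq_intros refl D | simp add: D)+
    using D apply (simp add: divide_simps)
    apply algebra
    done
  from has_vector_derivative_real_field[OF this] show ?thesis
    by (simp add: L_def D_def E_def)
qed

text \<open>The substitution \<open>\<rho> = 2 * b / (\<kappa> + b)\<close> makes the double root
  relations polynomial: \<open>Z\<close> is 4 times the first one and \<open>E\<close> is twice the
  second. \<open>V\<close> is the coefficient of \<open>t\<close> in
  \<open>y / (2 * \<kappa>)\<close>, and \<open>c\<close> is the temporal frequency of the phase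
  with the background contribution \<open>A1 + A2 / 2\<close> added. The conclusions are the
  conditions under which the residual of the ansatz vanishes.\<close>

lemma rational_ansatz_coefficients:
  fixes \<kappa> V b1 b2 \<rho>1 \<rho>2 A1 A2 Z c :: real
  assumes b: "b1 \<noteq> 0" "b2 \<noteq> 0"
    and r1: "\<kappa> * \<rho>1 = b1 * (2 - \<rho>1)" and r2: "\<kappa> * \<rho>2 = b2 * (2 - \<rho>2)"
    and Z: "A1 * \<rho>1\<^sup>2 + A2 * \<rho>2\<^sup>2 = 4 * Z"
    and E: "2 * \<kappa> * Z - 4 + A1 * b1 * \<rho>1 + A2 * b2 * \<rho>2 = 0"
    and V: "2 * V * b1 * b2 = 2 * \<kappa> * Z - 2 + Z * (b1 + b2)"
    and c: "2 * b1 * c = 2 - A2 * b2"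
  shows "8 * \<kappa> * V + A1 * (\<rho>1\<^sup>2 - 2 * \<rho>1) + A2 * (\<rho>2\<^sup>2 - 2 * \<rho>2) = 0" (is "?P0")
   "-8 * \<kappa>\<^sup>2 * V * \<rho>1 + 4 * \<kappa> * \<rho>1 * (b1 * V + c) + (A1 * (\<rho>1\<^sup>2 - 2 * \<rho>1) + A2 / 2 * (\<rho>2\<^sup>2 - 2 * \<rho>2)) * b1 * \<rho>1
      - A2 / 2 * (2 * \<kappa> * \<rho>2 * (\<rho>2 - 2 - \<rho>1) - b2 * \<rho>1 * (\<rho>2\<^sup>2 - 2 * \<rho>2)) = 0" (is "?P1")
   "4 * \<kappa> * \<rho>1 * (b1 * V + c) + 2 * A1 * (\<rho>1\<^sup>2 - 2 * \<rho>1) * b1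
        + A2 * ((\<rho>2\<^sup>2 - 2 * \<rho>2) * (b1 + b2) + 2 * \<kappa> * \<rho>2) = 0" (is "?P2")
proof -
  \<comment> \<open>The product of \<open>\<kappa>\<close> and \<open>Z\<close> is eliminated, since
    \<open>r1\<close> and \<open>r2\<close> turn each \<open>\<kappa> * \<rho>\<^sup>2\<close> into
    \<open>b * \<rho> * (2 - \<rho>)\<close>.\<close>
  have E': "A1 * b1 * (\<rho>1\<^sup>2 - 4 * \<rho>1) + A2 * b2 * (\<rho>2\<^sup>2 - 4 * \<rho>2) = - 8"
    using r1 r2 Z E by algebra
  have "b1 * b2 * (8 * \<kappa> * V + A1 * (\<rho>1\<^sup>2 - 2 * \<rho>1) + A2 * (\<rho>2\<^sup>2 - 2 * \<rho>2)) = 0"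
    using r1 r2 Z V E' by algebra
  then show P0: ?P0 using b by simp
  show ?P1 using P0 r1 r2 c E' by algebra
  show ?P2 using P0 r1 r2 c E' by algebra
qed

text \<open>
  Here \<open>h = 1 / (y + j)\<close> and \<open>hb = 1 / (y - j)\<close>. Dividing the left-hand side by \<open>h\<^sup>3 * hb\<close> leaves a
  quadratic polynomial in \<open>1 / h\<close> whose coefficients are multiples of the left-hand sides of \<open>P0\<close>,
  \<open>P1\<close> and \<open>P2\<close>.
\<close>

lemma rational_ansatz_residual:
  fixes j \<kappa> V b1 b2 \<rho>1 \<rho>2 A1 A2 c w h hb :: complex
  assumes j: "j * j = -1" and h: "hb - h = 2 * j * h * hb"
    and w: "w = c - A1 - A2 / 2"
    and c: "2 * b1 * c = 2 - A2 * b2"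
    and P0: "8 * \<kappa> * V + A1 * (\<rho>1\<^sup>2 - 2 * \<rho>1) + A2 * (\<rho>2\<^sup>2 - 2 * \<rho>2) = 0"
    and P1: "-8 * \<kappa>\<^sup>2 * V * \<rho>1 + 4 * \<kappa> * \<rho>1 * (b1 * V + c) + (A1 * (\<rho>1\<^sup>2 - 2 * \<rho>1) + A2 / 2 * (\<rho>2\<^sup>2 - 2 * \<rho>2)) * b1 * \<rho>1
      - A2 / 2 * (2 * \<kappa> * \<rho>2 * (\<rho>2 - 2 - \<rho>1) - b2 * \<rho>1 * (\<rho>2\<^sup>2 - 2 * \<rho>2)) = 0"
    and P2: "4 * \<kappa> * \<rho>1 * (b1 * V + c) + 2 * A1 * (\<rho>1\<^sup>2 - 2 * \<rho>1) * b1
        + A2 * ((\<rho>2\<^sup>2 - 2 * \<rho>2) * (b1 + b2) + 2 * \<kappa> * \<rho>2) = 0"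
  shows "2 * \<kappa> * V * (- (4 * \<kappa> * j * \<rho>1 * h^3) + j * b1 * (j * \<rho>1 * h\<^sup>2))
      + j * w * (2 * \<kappa> * j * \<rho>1 * h\<^sup>2 + j * b1 * (1 - j * \<rho>1 * h))
      + (1 - j * \<rho>1 * h)
      + j * (A1 * ((1 - j * \<rho>1 * h) * (1 + j * \<rho>1 * hb)) + A2 / 2 * ((1 - j * \<rho>2 * h) * (1 + j * \<rho>2 * hb)))
          * (2 * \<kappa> * j * \<rho>1 * h\<^sup>2 + j * b1 * (1 - j * \<rho>1 * h))
      + j / 2 * A2 * (1 - j * \<rho>1 * h) * (1 + j * \<rho>2 * hb) * (2 * \<kappa> * j * \<rho>2 * h\<^sup>2 + j * b2 * (1 - j * \<rho>2 * h)) = 0"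
  using assms by algebra

text \<open>Every term of the equation is proportional to \<open>C1 * E1\<close>, because the phase
  of the second component meets its own conjugate in the coupling term. What remains is an identity
  between rational amplitudes.\<close>

lemma common_phase_factor:
  fixes j \<tau>1 \<tau>2 C1 C2 Q X1 X1b X2 X2b P1 P2 E1 E2 E2b :: complex
  assumes "E2 * E2b = 1"
    and "Q + X1 + j * (\<tau>1 * C1\<^sup>2 * (X1 * X1b) + \<tau>2 * C2\<^sup>2 / 2 * (X2 * X2b)) * P1
      + j / 2 * (\<tau>2 * C2\<^sup>2) * X1 * X2b * P2 = 0"
  shows "C1 * Q * E1 + C1 * X1 * E1
      + j * (\<tau>1 * (C1\<^sup>2 * (X1 * X1b)) + \<tau>2 / 2 * (C2\<^sup>2 * (X2 * X2b))) * (C1 * P1 * E1)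
      + j / 2 * \<tau>2 * (C1 * X1 * E1) * (C2 * X2b * E2b) * (C2 * P2 * E2) = 0"
  using assms by algebra

text \<open>
  The first equation of the system is the case \<open>\<tau>1 = 1\<close>, \<open>\<tau>2 = \<sigma>\<close>; the second one is the case
  \<open>\<tau>1 = \<sigma>\<close>, \<open>\<tau>2 = 1\<close> with the two components exchanged.
\<close>

lemma rational_ansatz_equation:
  fixes \<tau>1 \<tau>2 \<kappa> z b1 b2 a1 a2 y :: real and E1 E2 :: complex
  defines "\<rho>1 \<equiv> 2 * b1 / (\<kappa> + b1)" and "\<rho>2 \<equiv> 2 * b2 / (\<kappa> + b2)"
  defines "h \<equiv> 1 / (complex_of_real y + \<i>)"
  defines "V \<equiv> 1 / (b1 * b2 * z) * (\<kappa> - z + (b1 + b2) / 2)"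
  defines "u1 \<equiv> of_real a1 * (1 - \<i> * of_real \<rho>1 * h) * E1"
  defines "u2 \<equiv> of_real a2 * (1 - \<i> * of_real \<rho>2 * h) * E2"
  defines "p1 \<equiv> of_real a1 * (2 * of_real \<kappa> * \<i> * of_real \<rho>1 * h\<^sup>2 + \<i> * of_real b1 * (1 - \<i> * of_real \<rho>1 * h)) * E1"
  defines "p2 \<equiv> of_real a2 * (2 * of_real \<kappa> * \<i> * of_real \<rho>2 * h\<^sup>2 + \<i> * of_real b2 * (1 - \<i> * of_real \<rho>2 * h)) * E2"
  assumes nz: "z \<noteq> 0" "b1 \<noteq> 0" "b2 \<noteq> 0" "\<kappa> + b1 \<noteq> 0" "\<kappa> + b2 \<noteq> 0"
    and I1: "\<tau>1 * a1\<^sup>2 * b1\<^sup>2 / (\<kappa> + b1)\<^sup>2 + \<tau>2 * a2\<^sup>2 * b2\<^sup>2 / (\<kappa> + b2)\<^sup>2 = 1 / z"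
    and I2: "\<kappa> / z - 2 + \<tau>1 * a1\<^sup>2 * b1\<^sup>2 / (\<kappa> + b1) + \<tau>2 * a2\<^sup>2 * b2\<^sup>2 / (\<kappa> + b2) = 0"
    and w: "w = - 1 / 2 * (2 * (\<tau>1 * a1\<^sup>2) + \<tau>2 * a2\<^sup>2 - 2 / b1 + \<tau>2 * a2\<^sup>2 * (b2 / b1))"
    and E: "E1 * cnj E1 = 1" "E2 * cnj E2 = 1"
  shows "of_real a1 * (2 * of_real \<kappa> * of_real V * (- (4 * of_real \<kappa> * \<i> * of_real \<rho>1 * h^3) + \<i> * of_real b1 * (\<i> * of_real \<rho>1 * h\<^sup>2))
      + \<i> * of_real w * (2 * of_real \<kappa> * \<i> * of_real \<rho>1 * h\<^sup>2 + \<i> * of_real b1 * (1 - \<i> * of_real \<rho>1 * h))) * E1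
    + u1 + \<i> * of_real (\<tau>1 * (cmod u1)\<^sup>2 + \<tau>2 / 2 * (cmod u2)\<^sup>2) * p1 + \<i> / 2 * of_real \<tau>2 * u1 * cnj u2 * p2 = 0"
proof -
  \<comment> \<open>The signs are absorbed into \<open>A1\<close> and \<open>A2\<close>, so that
    both equations of the system lead to the same polynomial identities.\<close>
  define A1 A2 c where "A1 = \<tau>1 * a1\<^sup>2" and "A2 = \<tau>2 * a2\<^sup>2" and "c = w + A1 + A2 / 2"
  have r: "\<kappa> * \<rho>1 = b1 * (2 - \<rho>1)" "\<kappa> * \<rho>2 = b2 * (2 - \<rho>2)"
    using nz by (simp_all add: \<rho>1_def \<rho>2_def field_simps)
  have Z: "A1 * \<rho>1\<^sup>2 + A2 * \<rho>2\<^sup>2 = 4 * (1 / z)"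
    unfolding I1[symmetric] by (simp add: A1_def A2_def \<rho>1_def \<rho>2_def power_divide power_mult_distrib algebra_simps)
  have "2 * \<kappa> * (1 / z) - 4 + A1 * b1 * \<rho>1 + A2 * b2 * \<rho>2
      = 2 * (\<kappa> / z - 2 + \<tau>1 * a1\<^sup>2 * b1\<^sup>2 / (\<kappa> + b1) + \<tau>2 * a2\<^sup>2 * b2\<^sup>2 / (\<kappa> + b2))"
    by (simp add: A1_def A2_def \<rho>1_def \<rho>2_def power2_eq_square algebra_simps)
  with I2 have E0: "2 * \<kappa> * (1 / z) - 4 + A1 * b1 * \<rho>1 + A2 * b2 * \<rho>2 = 0" by simp
  have V: "2 * V * b1 * b2 = 2 * \<kappa> * (1 / z) - 2 + (1 / z) * (b1 + b2)"
    using nz by (simp add: V_def field_simps)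
  have c: "2 * b1 * c = 2 - A2 * b2"
    using nz by (simp add: c_def w A1_def A2_def field_simps)
  note P = rational_ansatz_coefficients[OF nz(2,3) r Z E0 V c]
  note PC = P[THEN arg_cong[of _ _ complex_of_real], simplified of_real_add of_real_diff of_real_mult of_real_divide
        of_real_power of_real_minus of_real_numeral of_real_0]
  have "c - A1 - A2 / 2 = w" by (simp add: c_def)
  then have wC: "of_real w = complex_of_real c - of_real A1 - of_real A2 / 2"
    by (metis of_real_diff of_real_divide of_real_numeral)
  have cC: "2 * complex_of_real b1 * of_real c = 2 - of_real A2 * of_real b2"
    using arg_cong[OF c, of complex_of_real] by simp
  have D: "complex_of_real y + \<i> \<noteq> 0" "complex_of_real y - \<i> \<noteq> 0"
    by (simp_all add: complex_eq_iff)
  then have hb: "cnj h - h = 2 * \<i> * h * cnj h"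
    by (simp add: h_def field_simps)
  have nu1: "complex_of_real ((cmod u1)\<^sup>2) = of_real a1 ^ 2 * ((1 - \<i> * of_real \<rho>1 * h) * (1 + \<i> * of_real \<rho>1 * cnj h))"
    and nu2: "complex_of_real ((cmod u2)\<^sup>2) = of_real a2 ^ 2 * ((1 - \<i> * of_real \<rho>2 * h) * (1 + \<i> * of_real \<rho>2 * cnj h))"
    unfolding complex_norm_square u1_def u2_def using E by (simp_all add: power2_eq_square)
  have A: "complex_of_real A1 = of_real \<tau>1 * of_real a1 ^ 2" "complex_of_real A2 = of_real \<tau>2 * of_real a2 ^ 2"
    by (simp_all add: A1_def A2_def)
  have cu2: "cnj u2 = of_real a2 * (1 + \<i> * of_real \<rho>2 * cnj h) * cnj E2"
    by (simp add: u2_def)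
  have "\<i> * \<i> = -1" by simp
  note R = rational_ansatz_residual[OF this hb wC cC PC(1) _ PC(3)]
  have R': "2 * of_real \<kappa> * of_real V * (- (4 * of_real \<kappa> * \<i> * of_real \<rho>1 * h^3) + \<i> * of_real b1 * (\<i> * of_real \<rho>1 * h\<^sup>2))
      + \<i> * of_real w * (2 * of_real \<kappa> * \<i> * of_real \<rho>1 * h\<^sup>2 + \<i> * of_real b1 * (1 - \<i> * of_real \<rho>1 * h))
      + (1 - \<i> * of_real \<rho>1 * h)
      + \<i> * (of_real A1 * ((1 - \<i> * of_real \<rho>1 * h) * (1 + \<i> * of_real \<rho>1 * cnj h))
           + of_real A2 / 2 * ((1 - \<i> * of_real \<rho>2 * h) * (1 + \<i> * of_real \<rho>2 * cnj h)))
          * (2 * of_real \<kappa> * \<i> * of_real \<rho>1 * h\<^sup>2 + \<i> * of_real b1 * (1 - \<i> * of_real \<rho>1 * h))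
      + \<i> / 2 * of_real A2 * (1 - \<i> * of_real \<rho>1 * h) * (1 + \<i> * of_real \<rho>2 * cnj h)
          * (2 * of_real \<kappa> * \<i> * of_real \<rho>2 * h\<^sup>2 + \<i> * of_real b2 * (1 - \<i> * of_real \<rho>2 * h)) = 0"
    by (rule R) (use PC(2) in simp)
  show ?thesis
    unfolding of_real_add of_real_mult nu1 nu2 cu2 of_real_divide of_real_numeral
    unfolding u1_def p1_def p2_def
    by (rule common_phase_factor[OF E(2) R'[unfolded A]])
qed

text \<open>Partial fractions: the numerator of the bracket minus its denominator is
  \<open>- \<i>\<close> times \<open>2 * b s / (\<kappa> + b s)\<close>. In this form the dependence
  on \<open>y\<close> sits in a single simple pole.\<close>

lemma rational_soliton_eq:
  assumes "\<kappa> + b s \<noteq> 0"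
  shows "rational_soliton \<sigma> a b z \<kappa> s x t = of_real (a s)
     * (1 - \<i> * of_real (2 * b s / (\<kappa> + b s))
          * (1 / (of_real (2 * \<kappa> * (x + 1 / (b 1 * b 2 * z) * (\<kappa> - z + (b 1 + b 2) / 2) * t)) + \<i>)))
     * exp (\<i> * of_real (phase \<sigma> a b s x t))"
proof -
  define y where "y = 2 * \<kappa> * (x + 1 / (b 1 * b 2 * z) * (\<kappa> - z + (b 1 + b 2) / 2) * t)"
  have D: "complex_of_real y + \<i> \<noteq> 0"
    by (simp add: complex_eq_iff)
  have "(\<kappa> - b s) / (\<kappa> + b s) = 1 - 2 * b s / (\<kappa> + b s)"
    using assms by (simp add: field_simps)
  then have "(of_real y + \<i> * of_real ((\<kappa> - b s) / (\<kappa> + b s))) / (of_real y + \<i>)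
      = 1 - \<i> * of_real (2 * b s / (\<kappa> + b s)) * (1 / (of_real y + \<i>))"
    using D by (simp only: of_real_diff of_real_1) (simp add: divide_simps, simp add: algebra_simps)
  then show ?thesis
    unfolding rational_soliton_def Let_def y_def[symmetric] by simp
qed

lemma coupled_FL_solution_rational_soliton:
  assumes nz: "z \<noteq> 0" "b 1 \<noteq> 0" "b 2 \<noteq> 0" "\<kappa> + b 1 \<noteq> 0" "\<kappa> + b 2 \<noteq> 0"
    and I1: "(a 1)\<^sup>2 * (b 1)\<^sup>2 / (\<kappa> + b 1)\<^sup>2 + \<sigma> * (a 2)\<^sup>2 * (b 2)\<^sup>2 / (\<kappa> + b 2)\<^sup>2 = 1 / z"
    and I2: "\<kappa> / z - 2 + (a 1)\<^sup>2 * (b 1)\<^sup>2 / (\<kappa> + b 1) + \<sigma> * (a 2)\<^sup>2 * (b 2)\<^sup>2 / (\<kappa> + b 2) = 0"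
  shows "coupled_FL_solution \<sigma> (rational_soliton \<sigma> a b z \<kappa>)"
proof -
  define V where "V = 1 / (b 1 * b 2 * z) * (\<kappa> - z + (b 1 + b 2) / 2)"
  define w where "w s = (if s = 1 then - 1 / 2 * (2 * (a 1)\<^sup>2 + \<sigma> * (a 2)\<^sup>2 - 2 / b 1 + \<sigma> * (a 2)\<^sup>2 * (b 2 / b 1))
      else - 1 / 2 * (2 * \<sigma> * (a 2)\<^sup>2 + (a 1)\<^sup>2 - 2 / b 2 + (a 1)\<^sup>2 * (b 1 / b 2)))" for s :: nat
  define \<rho> where "\<rho> s = 2 * b s / (\<kappa> + b s)" for s
  define h where "h x t = 1 / (complex_of_real (2 * \<kappa> * (x + V * t)) + \<i>)" for x t
  define E where "E s x t = exp (\<i> * complex_of_real (b s * x + w s * t))" for s x t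
  \<comment> \<open>\<open>p\<close> and \<open>q\<close> are the \<open>x\<close> and the mixed
    derivative, written out with the rules that \<open>h\<close> has \<open>x\<close> derivative
    \<open>- 2 * \<kappa> * h\<^sup>2\<close> and \<open>t\<close> derivative \<open>V\<close> times
    that.\<close>
  define p where "p s x t = of_real (a s) * (2 * of_real \<kappa> * \<i> * of_real (\<rho> s) * (h x t)\<^sup>2
      + \<i> * of_real (b s) * (1 - \<i> * of_real (\<rho> s) * h x t)) * E s x t" for s x t
  define q where "q s x t = of_real (a s) * (2 * of_real \<kappa> * of_real V * (- (4 * of_real \<kappa> * \<i> * of_real (\<rho> s) * (h x t)^3)
        + \<i> * of_real (b s) * (\<i> * of_real (\<rho> s) * (h x t)\<^sup>2))
      + \<i> * of_real (w s) * (2 * of_real \<kappa> * \<i> * of_real (\<rho> s) * (h x t)\<^sup>2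
        + \<i> * of_real (b s) * (1 - \<i> * of_real (\<rho> s) * h x t))) * E s x t" for s x t
  have u: "rational_soliton \<sigma> a b z \<kappa> s x t = of_real (a s) * (1 - \<i> * of_real (\<rho> s) * h x t) * E s x t"
    if "s \<in> {1, 2}" for s x t
  proof -
    have "phase \<sigma> a b s x t = b s * x + w s * t"
      using that by (auto simp: phase_def w_def)
    moreover have "\<kappa> + b s \<noteq> 0" using nz that by auto
    ultimately show ?thesis
      by (simp add: rational_soliton_eq \<rho>_def h_def E_def V_def)
  qed
  have dx: "((\<lambda>x. rational_soliton \<sigma> a b z \<kappa> s x t) has_vector_derivative p s x t) (at x)"
    if "s \<in> {1, 2}" for s x t
    using has_vector_derivative_exp_Laurent[of "of_real (a s)" 1 "- \<i> * of_real (\<rho> s)" "2 * \<kappa>" "2 * \<kappa> * V * t" 0 "b s" "w s * t" x]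
    by (simp add: u[OF that] p_def h_def E_def algebra_simps power_divide)
  have dt: "((\<lambda>t. p s x t) has_vector_derivative q s x t) (at t)" for s x t
    using has_vector_derivative_exp_Laurent[of "of_real (a s)" "\<i> * of_real (b s)" "of_real (b s) * of_real (\<rho> s)"
        "2 * \<kappa> * V" "2 * \<kappa> * x" "2 * of_real \<kappa> * \<i> * of_real (\<rho> s)" "w s" "b s * x" t]
    by (simp add: q_def p_def h_def E_def algebra_simps power_divide)
  have unit: "E s x t * cnj (E s x t) = 1" for s x t
    unfolding complex_norm_square[symmetric] E_def by simp
  \<comment> \<open>The second equation is obtained by exchanging the components, which permutes
    \<open>b 1\<close> and \<open>b 2\<close> in the velocity coefficient.\<close>
  have V': "1 / (b 2 * b 1 * z) * (\<kappa> - z + (b 2 + b 1) / 2) = V"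
    by (simp add: V_def algebra_simps)
  have sw: "\<sigma> * (a 2)\<^sup>2 * (b 2)\<^sup>2 / (\<kappa> + b 2)\<^sup>2 + 1 * (a 1)\<^sup>2 * (b 1)\<^sup>2 / (\<kappa> + b 1)\<^sup>2 = 1 / z"
    "\<kappa> / z - 2 + \<sigma> * (a 2)\<^sup>2 * (b 2)\<^sup>2 / (\<kappa> + b 2) + 1 * (a 1)\<^sup>2 * (b 1)\<^sup>2 / (\<kappa> + b 1) = 0"
    "1 * (a 1)\<^sup>2 * (b 1)\<^sup>2 / (\<kappa> + b 1)\<^sup>2 + \<sigma> * (a 2)\<^sup>2 * (b 2)\<^sup>2 / (\<kappa> + b 2)\<^sup>2 = 1 / z"
    "\<kappa> / z - 2 + 1 * (a 1)\<^sup>2 * (b 1)\<^sup>2 / (\<kappa> + b 1) + \<sigma> * (a 2)\<^sup>2 * (b 2)\<^sup>2 / (\<kappa> + b 2) = 0"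
    using I1 I2 by simp_all
  have w': "w 1 = - 1 / 2 * (2 * (1 * (a 1)\<^sup>2) + \<sigma> * (a 2)\<^sup>2 - 2 / b 1 + \<sigma> * (a 2)\<^sup>2 * (b 2 / b 1))"
    "w 2 = - 1 / 2 * (2 * (\<sigma> * (a 2)\<^sup>2) + 1 * (a 1)\<^sup>2 - 2 / b 2 + 1 * (a 1)\<^sup>2 * (b 1 / b 2))"
    by (simp_all add: w_def)
  note eq1 = rational_ansatz_equation[OF nz sw(3,4) w'(1) unit unit]
  note eq2 = rational_ansatz_equation[OF nz(1,3,2,5,4) sw(1,2) w'(2) unit unit, unfolded V']
  show ?thesis
    unfolding coupled_FL_solution_def
  proof (rule exI[of _ p], rule exI[of _ q], intro allI conjI ballI)
    fix x t
    show "q 1 x t + rational_soliton \<sigma> a b z \<kappa> 1 x t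
        + \<i> * of_real ((cmod (rational_soliton \<sigma> a b z \<kappa> 1 x t))\<^sup>2 + \<sigma> / 2 * (cmod (rational_soliton \<sigma> a b z \<kappa> 2 x t))\<^sup>2) * p 1 x t
        + \<i> / 2 * of_real \<sigma> * rational_soliton \<sigma> a b z \<kappa> 1 x t * cnj (rational_soliton \<sigma> a b z \<kappa> 2 x t) * p 2 x t = 0"
      using eq1[of "2 * \<kappa> * (x + V * t)" 1 x t 2 x t]
      unfolding V_def[symmetric] \<rho>_def[symmetric] h_def[symmetric]
      by (simp add: u q_def p_def)
    show "q 2 x t + rational_soliton \<sigma> a b z \<kappa> 2 x t
        + \<i> * of_real (\<sigma> * (cmod (rational_soliton \<sigma> a b z \<kappa> 2 x t))\<^sup>2 + 1 / 2 * (cmod (rational_soliton \<sigma> a b z \<kappa> 1 x t))\<^sup>2) * p 2 x t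
        + \<i> / 2 * rational_soliton \<sigma> a b z \<kappa> 2 x t * cnj (rational_soliton \<sigma> a b z \<kappa> 1 x t) * p 1 x t = 0"
      using eq2[of "2 * \<kappa> * (x + V * t)" 2 x t 1 x t]
      unfolding \<rho>_def[symmetric] h_def[symmetric]
      by (simp add: u q_def p_def)
  qed (use dx dt in auto)
qed

section \<open>The dark soliton formula in the limit of a real root\<close>

lemma tendsto_exp_diff_quotient:
  fixes X \<eta> :: "nat \<Rightarrow> real"
  assumes "X \<longlonglongrightarrow> l" "\<eta> \<longlonglongrightarrow> 0" "\<And>n. \<eta> n \<noteq> 0"
  shows "(\<lambda>n. (exp (\<eta> n * X n) - 1) / \<eta> n) \<longlonglongrightarrow> l"
proof -
  have "DERIV exp (0::real) :> 1"
    using DERIV_exp[of "0::real"] by simp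
  \<comment> \<open>The Caratheodory form of the derivative avoids a division by
    \<open>\<eta> n * X n\<close>, which may vanish.\<close>
  then obtain g where g: "\<And>v::real. exp v - 1 = g v * v" "isCont g 0" "g 0 = 1"
    unfolding CARAT_DERIV by auto
  have "(\<lambda>n. \<eta> n * X n) \<longlonglongrightarrow> 0"
    using tendsto_mult[OF assms(2,1)] by simp
  then have "(\<lambda>n. g (\<eta> n * X n)) \<longlonglongrightarrow> 1"
    using isCont_tendsto_compose[OF g(2)] g(3) by simp
  from tendsto_mult[OF this assms(1)] show ?thesis
    by (simp add: g(1) assms(3))
qed

text \<open>The exponent carries the factor \<open>Im k\<close>. Hence the exponential tends to 1 as
  the root becomes real, and its first-order term brings in the affine function of \<open>x\<close>
  and \<open>t\<close>.\<close>

lemma theta_add_cnj: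
  "theta b z k x t + cnj (theta b z k x t)
    = of_real (Im k * (- 2 * (x + 1 / (b 1 * b 2 * z) * (Re k - z + (b 1 + b 2) / 2) * t)))"
proof -
  define r where "r = 1 / (b 1 * b 2 * z)"
  have c: "1 / complex_of_real (2 * b 1 * b 2 * z) = of_real (r / 2)" by (simp add: r_def)
  have "2 * Re (theta b z k x t) = Im k * (- 2 * (x + r * (Re k - z + (b 1 + b 2) / 2) * t))"
    unfolding theta_def c by simp algebra
  then show ?thesis
    unfolding complex_add_cnj by (simp only: r_def)
qed

text \<open>
  Numerator and denominator of the soliton formula both vanish in the limit; they are divided by
  \<open>Im K\<close> and the quotients converge.
\<close>

lemma dark_soliton_tendsto_rational_soliton:
  fixes B :: "nat \<Rightarrow> nat \<Rightarrow> real" and K :: "nat \<Rightarrow> complex"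
  assumes s: "s \<in> {1, 2}"
    and A: "\<And>s. s \<in> {1, 2} \<Longrightarrow> (\<lambda>n. A n s) \<longlonglongrightarrow> a s"
    and B: "\<And>s. s \<in> {1, 2} \<Longrightarrow> (\<lambda>n. B n s) \<longlonglongrightarrow> b s"
    and Z: "Z \<longlonglongrightarrow> z" and K: "K \<longlonglongrightarrow> of_real \<kappa>" and nonreal: "\<And>n. K n \<notin> \<real>"
    and sgn: "(\<lambda>n. (Re (K n) + \<epsilon> * cmod (K n)) / Im (K n)) \<longlonglongrightarrow> 0"
    and nz: "z \<noteq> 0" "b 1 \<noteq> 0" "b 2 \<noteq> 0" "\<kappa> + b 1 \<noteq> 0" "\<kappa> + b 2 \<noteq> 0"
  shows "(\<lambda>n. dark_soliton \<sigma> (A n) (B n) (Z n) \<epsilon> (K n) s x t) \<longlonglongrightarrow> rational_soliton \<sigma> a b z \<kappa> s x t"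
proof -
  define \<eta> where "\<eta> n = Im (K n)" for n
  define X where "X n = - 2 * (x + 1 / (B n 1 * B n 2 * Z n) * (Re (K n) - Z n + (B n 1 + B n 2) / 2) * t)" for n
  define y where "y = 2 * \<kappa> * (x + 1 / (b 1 * b 2 * z) * (\<kappa> - z + (b 1 + b 2) / 2) * t)"
  define e where "e n = complex_of_real (exp (\<eta> n * X n))" for n
  define c where "c n = K n + of_real (B n s)" for n
  define ph where "ph n = (cnj (K n) + of_real (B n s)) / c n" for n
  \<comment> \<open>\<open>d\<close> measures how well \<open>\<epsilon> * cmod (K n)\<close>
    cancels \<open>Re (K n)\<close>, on the scale of the imaginary part.\<close>
  define d where "d n = (Re (K n) + \<epsilon> * cmod (K n)) / \<eta> n" for n
  define f where "f n = (exp (\<eta> n * X n) - 1) / \<eta> n" for n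
  have \<eta>0: "\<eta> n \<noteq> 0" for n
    using nonreal[of n] by (simp add: \<eta>_def complex_is_Real_iff)
  have cn: "c n \<noteq> 0" for n
    using \<eta>0[of n] by (auto simp: \<eta>_def c_def complex_eq_iff)
  have k: "K n = of_real (Re (K n)) + \<i> * of_real (\<eta> n)" "cnj (K n) = of_real (Re (K n)) - \<i> * of_real (\<eta> n)" for n
    by (simp_all add: complex_eq_iff \<eta>_def)
  have ph: "ph n - 1 = of_real (\<eta> n) * (- 2 * \<i> / c n)" for n
  proof -
    have "cnj (K n) + of_real (B n s) - c n = of_real (\<eta> n) * (- 2 * \<i>)"
      using k[of n] by (simp add: c_def complex_eq_iff)
    moreover have "ph n - 1 = (cnj (K n) + of_real (B n s) - c n) / c n"
      using cn[of n] by (simp add: ph_def diff_divide_distrib)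
    ultimately show ?thesis by simp
  qed
  have e: "e n - 1 = of_real (\<eta> n) * of_real (f n)" for n
    using \<eta>0[of n] by (simp add: e_def f_def)
  have d: "of_real (Re (K n)) + of_real (\<epsilon> * cmod (K n)) = complex_of_real (\<eta> n) * of_real (d n)" for n
  proof -
    have "Re (K n) + \<epsilon> * cmod (K n) = \<eta> n * d n"
      using \<eta>0[of n] by (simp add: d_def)
    from arg_cong[OF this, of complex_of_real] show ?thesis
      by (simp only: of_real_add of_real_mult)
  qed
  \<comment> \<open>The terms of order zero cancel up to \<open>\<eta> n * d n\<close>. The
    remaining factor \<open>\<eta> n\<close> comes from \<open>K n - Re (K n)\<close> and from
    \<open>e * ph - 1 = (e - 1) * ph + (ph - 1)\<close>.\<close>
  have num: "K n * (e n * ph n) + of_real (\<epsilon> * cmod (K n))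
      = of_real (\<eta> n) * (\<i> * (e n * ph n) + of_real (Re (K n)) * (of_real (f n) * ph n - 2 * \<i> / c n) + of_real (d n))" for n
    using k(1)[of n] ph[of n] e[of n] d[of n] by algebra
  have den: "cnj (K n) * e n + of_real (\<epsilon> * cmod (K n))
      = of_real (\<eta> n) * (- \<i> * e n + of_real (Re (K n)) * of_real (f n) + of_real (d n))" for n
    using k(2)[of n] e[of n] d[of n] by algebra

  have \<eta>lim: "\<eta> \<longlonglongrightarrow> 0" and Relim: "(\<lambda>n. Re (K n)) \<longlonglongrightarrow> \<kappa>"
    using tendsto_Im[OF K] tendsto_Re[OF K] by (simp_all add: \<eta>_def[abs_def])
  have B1: "(\<lambda>n. B n 1) \<longlonglongrightarrow> b 1" and B2: "(\<lambda>n. B n 2) \<longlonglongrightarrow> b 2" and Bs: "(\<lambda>n. B n s) \<longlonglongrightarrow> b s"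
    and As: "(\<lambda>n. A n s) \<longlonglongrightarrow> a s"
    using A B s by auto
  have A1: "(\<lambda>n. A n 1) \<longlonglongrightarrow> a 1" and A2: "(\<lambda>n. A n 2) \<longlonglongrightarrow> a 2"
    using A by auto
  have bs: "\<kappa> + b s \<noteq> 0" using s nz by auto
  then have bs': "complex_of_real \<kappa> + of_real (b s) \<noteq> 0"
    by (metis of_real_add of_real_eq_0_iff)
  define X0 where "X0 = - 2 * (x + 1 / (b 1 * b 2 * z) * (\<kappa> - z + (b 1 + b 2) / 2) * t)"
  have "X \<longlonglongrightarrow> X0"
    unfolding X_def[abs_def] X0_def by (intro tendsto_intros B1 B2 Z Relim) (use nz in auto)
  have flim: "f \<longlonglongrightarrow> X0"
    unfolding f_def[abs_def] by (rule tendsto_exp_diff_quotient) fact+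
  have "(\<lambda>n. exp (\<eta> n * X n)) \<longlonglongrightarrow> exp (0 * X0)"
    by (intro tendsto_intros) fact+
  then have elim: "e \<longlonglongrightarrow> 1"
    unfolding e_def[abs_def] using tendsto_of_real by fastforce
  have clim: "c \<longlonglongrightarrow> of_real \<kappa> + of_real (b s)"
    unfolding c_def[abs_def] by (intro tendsto_intros K Bs)
  have phlim: "ph \<longlonglongrightarrow> 1"
  proof -
    have "ph \<longlonglongrightarrow> (cnj (of_real \<kappa>) + of_real (b s)) / (of_real \<kappa> + of_real (b s))"
      unfolding ph_def[abs_def] by (intro tendsto_intros clim K Bs bs' tendsto_cnj)
    with bs' show ?thesis by simp
  qed
  have dlim: "d \<longlonglongrightarrow> 0"
    using sgn by (simp add: d_def[abs_def] \<eta>_def)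
  have "(\<lambda>n. \<i> * (e n * ph n) + of_real (Re (K n)) * (of_real (f n) * ph n - 2 * \<i> / c n) + of_real (d n))
      \<longlonglongrightarrow> \<i> * (1 * 1) + of_real \<kappa> * (of_real X0 * 1 - 2 * \<i> / (of_real \<kappa> + of_real (b s))) + of_real 0" (is "?N \<longlonglongrightarrow> ?n")
    by (intro tendsto_intros elim phlim flim clim dlim Relim bs')
  moreover have "(\<lambda>n. - \<i> * e n + of_real (Re (K n)) * of_real (f n) + of_real (d n))
      \<longlonglongrightarrow> - \<i> * 1 + of_real \<kappa> * of_real X0 + of_real 0" (is "?D \<longlonglongrightarrow> ?d")
    by (intro tendsto_intros elim flim dlim Relim)
  \<comment> \<open>The imaginary part of the limit is -1, so the quotient converges also at points
    where \<open>y = 0\<close>.\<close>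
  moreover have d0: "?d \<noteq> 0" by (simp add: complex_eq_iff)
  ultimately have "(\<lambda>n. ?N n / ?D n) \<longlonglongrightarrow> ?n / ?d"
    by (intro tendsto_divide)
  moreover have "?n / ?d = (of_real y + \<i> * of_real ((\<kappa> - b s) / (\<kappa> + b s))) / (of_real y + \<i>)"
  proof -
    have "\<kappa> * X0 = - y" by (simp only: X0_def y_def mult_minus_left mult_minus_right ac_simps)
    then have X: "of_real \<kappa> * of_real X0 = - complex_of_real y"
      by (metis of_real_minus of_real_mult)
    have "\<i> - of_real \<kappa> * (2 * \<i> / (of_real \<kappa> + of_real (b s))) = - (\<i> * of_real ((\<kappa> - b s) / (\<kappa> + b s)))"
      using bs' by (simp add: divide_simps) (simp add: algebra_simps)
    then have "?n = - (of_real y + \<i> * of_real ((\<kappa> - b s) / (\<kappa> + b s)))" "?d = - (of_real y + \<i>)"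
      using X by (simp_all add: algebra_simps)
    then show ?thesis by (simp only: minus_divide_divide)
  qed
  ultimately have quot: "(\<lambda>n. ?N n / ?D n) \<longlonglongrightarrow> (of_real y + \<i> * of_real ((\<kappa> - b s) / (\<kappa> + b s))) / (of_real y + \<i>)"
    by simp
  have phase: "(\<lambda>n. phase \<sigma> (A n) (B n) s x t) \<longlonglongrightarrow> phase \<sigma> a b s x t"
    unfolding phase_def by (cases "s = 1") (auto intro!: tendsto_intros A1 A2 B1[simplified] B2 A1[simplified] simp: nz nz[simplified])
  have dark: "dark_soliton \<sigma> (A n) (B n) (Z n) \<epsilon> (K n) s x t
      = of_real (A n s) * (?N n / ?D n) * exp (\<i> * of_real (phase \<sigma> (A n) (B n) s x t))" for n
  proof -
    have "exp (theta (B n) (Z n) (K n) x t + cnj (theta (B n) (Z n) (K n) x t)) = e n"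
      unfolding theta_add_cnj e_def X_def \<eta>_def by (rule exp_of_real)
    moreover have "(cnj (K n) + of_real (B n s)) / (K n + of_real (B n s)) = ph n"
      by (simp add: ph_def c_def)
    moreover have "(K n * (e n * ph n) + of_real (\<epsilon> * cmod (K n))) / (cnj (K n) * e n + of_real (\<epsilon> * cmod (K n)))
        = ?N n / ?D n"
      unfolding num den using \<eta>0 by (intro nonzero_mult_divide_mult_cancel_left) simp
    ultimately show ?thesis
      unfolding dark_soliton_def Let_def by (simp only:)
  qed
  have rational: "rational_soliton \<sigma> a b z \<kappa> s x t
      = of_real (a s) * ((of_real y + \<i> * of_real ((\<kappa> - b s) / (\<kappa> + b s))) / (of_real y + \<i>))
        * exp (\<i> * of_real (phase \<sigma> a b s x t))"
    by (simp add: rational_soliton_def Let_def y_def)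
  show ?thesis
    unfolding dark rational by (intro tendsto_mult tendsto_exp tendsto_const tendsto_of_real As quot phase)
qed

text \<open>Rationalizing the numerator moves the cancellation into a denominator that stays away
  from 0 when \<open>\<epsilon>\<close> is opposite to the sign of \<open>Re k\<close>.\<close>

lemma sign_quotient_eq:
  assumes "\<epsilon>\<^sup>2 = 1" "Im k \<noteq> 0" "Re k - \<epsilon> * cmod k \<noteq> 0"
  shows "(Re k + \<epsilon> * cmod k) / Im k = - Im k / (Re k - \<epsilon> * cmod k)"
proof -
  have "(Re k + \<epsilon> * cmod k) * (Re k - \<epsilon> * cmod k) = - (Im k)\<^sup>2"
    using assms(1) cmod_power2[of k] by algebra
  with assms show ?thesis by (simp add: field_simps power2_eq_square)
qed

text \<open>With the sign opposite to that of \<open>\<kappa>\<close>, the rationalized denominator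
  tends to \<open>2 * \<kappa>\<close>, which is nonzero, while the numerator tends to 0. The
  direction in which \<open>K\<close> approaches \<open>\<kappa>\<close> is therefore
  irrelevant.\<close>

lemma sign_quotient_tendsto_0:
  assumes K: "K \<longlonglongrightarrow> complex_of_real \<kappa>" and "\<kappa> \<noteq> 0" and nonreal: "\<And>n. K n \<notin> \<real>"
  shows "(\<lambda>n. (Re (K n) + (- sgn \<kappa>) * cmod (K n)) / Im (K n)) \<longlonglongrightarrow> 0"
proof -
  have Re: "(\<lambda>n. Re (K n)) \<longlonglongrightarrow> \<kappa>" and Im: "(\<lambda>n. Im (K n)) \<longlonglongrightarrow> 0"
    using tendsto_Re[OF K] tendsto_Im[OF K] by simp_all
  have "\<kappa> - - sgn \<kappa> * cmod (of_real \<kappa>) = 2 * \<kappa>"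
    by (simp add: sgn_mult_abs)
  moreover have "(\<lambda>n. Re (K n) - - sgn \<kappa> * cmod (K n)) \<longlonglongrightarrow> \<kappa> - - sgn \<kappa> * cmod (of_real \<kappa>)"
    by (intro tendsto_intros Re K)
  ultimately have w: "(\<lambda>n. Re (K n) - - sgn \<kappa> * cmod (K n)) \<longlonglongrightarrow> 2 * \<kappa>"
    by simp
  then have ev: "\<forall>\<^sub>F n in sequentially. Re (K n) - - sgn \<kappa> * cmod (K n) \<noteq> 0"
    using \<open>\<kappa> \<noteq> 0\<close> by (intro tendsto_imp_eventually_ne[OF w]) simp
  have "(\<lambda>n. - Im (K n) / (Re (K n) - - sgn \<kappa> * cmod (K n))) \<longlonglongrightarrow> - 0 / (2 * \<kappa>)"
    by (intro tendsto_intros Im w) (use \<open>\<kappa> \<noteq> 0\<close> in simp)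
  moreover have "\<forall>\<^sub>F n in sequentially. - Im (K n) / (Re (K n) - - sgn \<kappa> * cmod (K n))
      = (Re (K n) + - sgn \<kappa> * cmod (K n)) / Im (K n)"
    using ev
  proof eventually_elim
    case (elim n)
    have "(- sgn \<kappa>)\<^sup>2 = 1" using \<open>\<kappa> \<noteq> 0\<close> by (simp add: sgn_if)
    moreover have "Im (K n) \<noteq> 0" using nonreal[of n] by (simp add: complex_is_Real_iff)
    ultimately show ?case using sign_quotient_eq elim by metis
  qed
  ultimately show ?thesis by (simp add: tendsto_cong)
qed

section \<open>Existence of dark soliton data that degenerate to the double root\<close>

lemma poly_characteristic_of_real:
  "poly (map_poly of_real (characteristic_poly \<sigma> a b z)) k =
    (if b 1 = b 2
     then (k / of_real z - 2) * (k + of_real (b 1)) + of_real (((a 1)\<^sup>2 + \<sigma> * (a 2)\<^sup>2) * (b 1)\<^sup>2)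
     else (k / of_real z - 2) * (k + of_real (b 1)) * (k + of_real (b 2))
       + of_real ((a 1)\<^sup>2 * (b 1)\<^sup>2) * (k + of_real (b 2)) + of_real (\<sigma> * (a 2)\<^sup>2 * (b 2)\<^sup>2) * (k + of_real (b 1)))"
  for k :: complex
  by (simp add: characteristic_poly_def map_poly_pCons algebra_simps add_divide_distrib)

text \<open>The amplitudes enter the characteristic equation only through their squares, so it
  suffices to prescribe convergent squares \<open>c1\<close> and \<open>c2\<close>. They are
  positive, or identically 0 in the case of \<open>a 2 = 0\<close>, only from some index
  \<open>N\<close> on, hence the shifted sequence.\<close>

lemma soliton_data_of_squares:
  assumes adm: "admissible a b z"
    and K: "K \<longlonglongrightarrow> of_real \<kappa>" and nonreal: "\<And>n. K n \<notin> \<real>"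
    and Z: "Z \<longlonglongrightarrow> z"
    and c1: "c1 \<longlonglongrightarrow> (a 1)\<^sup>2" and c2: "c2 \<longlonglongrightarrow> (a 2)\<^sup>2" and c20: "\<And>n. a 2 = 0 \<Longrightarrow> c2 n = 0"
    and root: "\<And>n \<alpha>. Z n \<noteq> 0 \<Longrightarrow> (\<alpha> 1)\<^sup>2 = c1 n \<Longrightarrow> (\<alpha> 2)\<^sup>2 = c2 n \<Longrightarrow>
      poly (map_poly of_real (characteristic_poly \<sigma> \<alpha> b (Z n))) (K n) = 0"
  shows "\<exists>N A B Z. soliton_data_tendsto \<sigma> A B Z (\<lambda>n. K (n + N)) a b z \<kappa>"
proof -
  \<comment> \<open>The sign of the limit is attached to the square root, so that the amplitudes
    converge to \<open>a s\<close> and not to its absolute value; for \<open>a 2 = 0\<close> this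
    factor gives 0, in agreement with \<open>c20\<close>.\<close>
  define A where "A n s = sgn (a s) * sqrt (if s = 1 then c1 n else c2 n)" for n s
  have nz: "z \<noteq> 0" "a 1 \<noteq> 0" using adm by (auto simp: admissible_def spectral_value_iff)
  have "\<forall>\<^sub>F n in sequentially. Z n \<noteq> 0"
    using Z nz(1) by (rule tendsto_imp_eventually_ne)
  moreover have "\<forall>\<^sub>F n in sequentially. 0 < c1 n"
    using order_tendstoD(1)[OF c1, of 0] nz by simp
  moreover have "\<forall>\<^sub>F n in sequentially. a 2 = 0 \<or> 0 < c2 n"
    using order_tendstoD(1)[OF c2, of 0] by (cases "a 2 = 0") simp_all
  ultimately have "\<forall>\<^sub>F n in sequentially. Z n \<noteq> 0 \<and> 0 < c1 n \<and> (a 2 = 0 \<or> 0 < c2 n)"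
    by eventually_elim simp
  then obtain N where N: "\<And>n. n \<ge> N \<Longrightarrow> Z n \<noteq> 0 \<and> 0 < c1 n \<and> (a 2 = 0 \<or> 0 < c2 n)"
    by (auto simp: eventually_sequentially)
  have A1: "(\<lambda>n. A n 1) \<longlonglongrightarrow> a 1"
  proof -
    have "(\<lambda>n. sgn (a 1) * sqrt (c1 n)) \<longlonglongrightarrow> sgn (a 1) * sqrt ((a 1)\<^sup>2)"
      by (intro tendsto_intros c1)
    then show ?thesis by (simp add: A_def sgn_mult_abs)
  qed
  have A2: "(\<lambda>n. A n 2) \<longlonglongrightarrow> a 2"
  proof -
    have "(\<lambda>n. sgn (a 2) * sqrt (c2 n)) \<longlonglongrightarrow> sgn (a 2) * sqrt ((a 2)\<^sup>2)"
      by (intro tendsto_intros c2)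
    then show ?thesis by (simp add: A_def sgn_mult_abs)
  qed
  have sq: "(A n 1)\<^sup>2 = c1 n \<and> (A n 2)\<^sup>2 = c2 n \<and> A n 1 \<noteq> 0 \<and> (a 2 \<noteq> 0 \<longrightarrow> A n 2 \<noteq> 0)" if "n \<ge> N" for n
    using N[OF that] nz(2) c20[of n] by (cases "a 2 = 0") (auto simp: A_def power_mult_distrib sgn_if)
  have "soliton_data_tendsto \<sigma> (\<lambda>n. A (n + N)) (\<lambda>n. b) (\<lambda>n. Z (n + N)) (\<lambda>n. K (n + N)) a b z \<kappa>"
    unfolding soliton_data_tendsto_def
  proof (intro conjI allI ballI)
    fix n
    have n: "n + N \<ge> N" by simp
    show "admissible (A (n + N)) b (Z (n + N))"
      using adm sq[OF n] N[OF n] by (auto simp: admissible_def spectral_value_iff)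
    show "K (n + N) \<notin> \<real>" by (rule nonreal)
    show "poly (map_poly of_real (characteristic_poly \<sigma> (A (n + N)) b (Z (n + N)))) (K (n + N)) = 0"
      using root[of "n + N" "A (n + N)"] sq[OF n] N[OF n] by blast
  next
    fix s :: nat assume "s \<in> {1, 2}"
    then show "(\<lambda>n. A (n + N) s) \<longlonglongrightarrow> a s"
      using LIMSEQ_ignore_initial_segment[OF A1, of N] LIMSEQ_ignore_initial_segment[OF A2, of N] by auto
  qed (use LIMSEQ_ignore_initial_segment[OF Z, of N] LIMSEQ_ignore_initial_segment[OF K, of N] in auto)
  then show ?thesis by blast
qed

text \<open>
  The carrier parameters stay fixed. If \<open>b 1 \<noteq> b 2\<close>, then \<open>K\<close> is a root iff two real equations hold
  that are linear in the squared amplitudes; they are solved with \<open>P\<close> and \<open>Q\<close>. If \<open>b 1 = b 2\<close>, then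
  only one combination of the amplitudes enters, and the real part of \<open>K\<close> has to be matched by
  moving \<open>z\<close>.
\<close>

lemma soliton_data_exist:
  assumes \<sigma>: "\<sigma> = 1 \<or> \<sigma> = -1" and adm: "admissible a b z"
    and n1: "\<kappa> + b 1 \<noteq> 0" and n2: "\<kappa> + b 2 \<noteq> 0"
    and I1: "(a 1)\<^sup>2 * (b 1)\<^sup>2 / (\<kappa> + b 1)\<^sup>2 + \<sigma> * (a 2)\<^sup>2 * (b 2)\<^sup>2 / (\<kappa> + b 2)\<^sup>2 = 1 / z"
    and I2: "\<kappa> / z - 2 + (a 1)\<^sup>2 * (b 1)\<^sup>2 / (\<kappa> + b 1) + \<sigma> * (a 2)\<^sup>2 * (b 2)\<^sup>2 / (\<kappa> + b 2) = 0"
    and K: "K \<longlonglongrightarrow> of_real \<kappa>" and nonreal: "\<And>n. K n \<notin> \<real>"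
  shows "\<exists>N A B Z. soliton_data_tendsto \<sigma> A B Z (\<lambda>n. K (n + N)) a b z \<kappa>"
proof -
  have nz: "z \<noteq> 0" "b 1 \<noteq> 0" "b 2 \<noteq> 0"
    using adm by (auto simp: admissible_def spectral_value_iff)
  have Re: "(\<lambda>n. Re (K n)) \<longlonglongrightarrow> \<kappa>"
    using tendsto_Re[OF K] by simp
  have K_cnj: "complex_of_real ((cmod (K n + of_real \<beta>))\<^sup>2) = (K n + of_real \<beta>) * (cnj (K n) + of_real \<beta>)"
    "complex_of_real (Re (K n)) = (K n + cnj (K n)) / 2" for n \<beta>
    unfolding complex_norm_square by (simp_all add: complex_add_cnj)
  \<comment> \<open>In the unknowns \<open>p\<close> and \<open>q\<close> both double root relations
    are linear, namely \<open>pq\<close> and \<open>pq'\<close>. The same system with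
    \<open>K n\<close> in place of \<open>\<kappa>\<close> determines \<open>P\<close> and
    \<open>Q\<close> below.\<close>
  define p q where "p = (a 1)\<^sup>2 * (b 1)\<^sup>2 / (\<kappa> + b 1)\<^sup>2" and "q = \<sigma> * (a 2)\<^sup>2 * (b 2)\<^sup>2 / (\<kappa> + b 2)\<^sup>2"
  define w where "w = 1 / z"
  have pa: "(a 1)\<^sup>2 = p * (\<kappa> + b 1)\<^sup>2 / (b 1)\<^sup>2" and qa: "(a 2)\<^sup>2 = \<sigma> * q * (\<kappa> + b 2)\<^sup>2 / (b 2)\<^sup>2"
    using n1 n2 nz \<sigma> by (auto simp: p_def q_def)
  have pq: "p + q = w" using I1 by (simp add: p_def q_def w_def)
  have "(a 1)\<^sup>2 * (b 1)\<^sup>2 / (\<kappa> + b 1) = p * (\<kappa> + b 1)" "\<sigma> * (a 2)\<^sup>2 * (b 2)\<^sup>2 / (\<kappa> + b 2) = q * (\<kappa> + b 2)"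
    using n1 n2 by (simp_all add: p_def q_def power2_eq_square)
  with I2 have pq': "\<kappa> * w - 2 + p * (\<kappa> + b 1) + q * (\<kappa> + b 2) = 0"
    by (simp add: w_def)
  show ?thesis
  proof (cases "b 1 = b 2")
    case True
    \<comment> \<open>These values come from Vieta's formulas: the quadratic shall have the roots
      \<open>K n\<close> and \<open>cnj (K n)\<close>, whose sum is \<open>2 * Z n - b 1\<close> and
      whose product is \<open>(cmod (K n))\<^sup>2\<close>.\<close>
    define Z where "Z n = Re (K n) + b 1 / 2" for n
    define c1 where "c1 n = ((cmod (K n))\<^sup>2 / Z n + 2 * b 1) / (b 1)\<^sup>2 - \<sigma> * (a 2)\<^sup>2" for n
    have "w * (2 * \<kappa> + b 1) = 2" using pq' True by (simp add: pq[symmetric] algebra_simps)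
    then have z: "z = \<kappa> + b 1 / 2" using nz by (simp add: w_def field_simps)
    have Z: "Z \<longlonglongrightarrow> z"
      unfolding Z_def[abs_def] z by (intro tendsto_intros Re)
    have "c1 \<longlonglongrightarrow> ((cmod (of_real \<kappa>))\<^sup>2 / z + 2 * b 1) / (b 1)\<^sup>2 - \<sigma> * (a 2)\<^sup>2"
      unfolding c1_def[abs_def] by (intro tendsto_intros K Z) (use nz in auto)
    moreover have "((cmod (of_real \<kappa>))\<^sup>2 / z + 2 * b 1) / (b 1)\<^sup>2 - \<sigma> * (a 2)\<^sup>2 = (a 1)\<^sup>2"
    proof -
      have zw: "z * w = 1" using nz by (simp add: w_def)
      have "\<sigma>\<^sup>2 = 1" using \<sigma> by auto
      then have "\<sigma> * (a 2)\<^sup>2 = q * (\<kappa> + b 1)\<^sup>2 / (b 1)\<^sup>2"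
        unfolding qa True by (simp add: power2_eq_square)
      then have "(a 1)\<^sup>2 + \<sigma> * (a 2)\<^sup>2 = (p + q) * (\<kappa> + b 1)\<^sup>2 / (b 1)\<^sup>2"
        unfolding pa by (simp add: algebra_simps add_divide_distrib)
      moreover have "w * (\<kappa> + b 1)\<^sup>2 = \<kappa>\<^sup>2 * w + 2 * b 1"
        using zw z by algebra
      ultimately have "(a 1)\<^sup>2 + \<sigma> * (a 2)\<^sup>2 = (\<kappa>\<^sup>2 * w + 2 * b 1) / (b 1)\<^sup>2"
        by (simp only: pq)
      then show ?thesis by (simp add: w_def)
    qed
    ultimately have c1: "c1 \<longlonglongrightarrow> (a 1)\<^sup>2" by simp
    show ?thesis
    proof (rule soliton_data_of_squares[OF adm K nonreal Z c1 tendsto_const])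
      fix n and \<alpha> :: "nat \<Rightarrow> real"
      assume Zn: "Z n \<noteq> 0" and \<alpha>: "(\<alpha> 1)\<^sup>2 = c1 n" "(\<alpha> 2)\<^sup>2 = (a 2)\<^sup>2"
      have "((\<alpha> 1)\<^sup>2 + \<sigma> * (\<alpha> 2)\<^sup>2) * (b 1)\<^sup>2 = (cmod (K n))\<^sup>2 / Z n + 2 * b 1"
        unfolding \<alpha> c1_def using nz by simp
      then have "complex_of_real (((\<alpha> 1)\<^sup>2 + \<sigma> * (\<alpha> 2)\<^sup>2) * (b 1)\<^sup>2) = K n * cnj (K n) / of_real (Z n) + 2 * of_real (b 1)"
        using K_cnj(1)[of n 0] by simp
      moreover have "K n + cnj (K n) + of_real (b 1) - 2 * of_real (Z n) = 0"
        by (simp add: Z_def complex_add_cnj)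
      moreover have "(K n / of_real (Z n) - 2) * (K n + of_real (b 1)) + (K n * cnj (K n) / of_real (Z n) + 2 * of_real (b 1))
          = K n / of_real (Z n) * (K n + cnj (K n) + of_real (b 1) - 2 * of_real (Z n))"
        using Zn by (simp add: field_simps)
      ultimately show "poly (map_poly of_real (characteristic_poly \<sigma> \<alpha> b (Z n))) (K n) = 0"
        unfolding poly_characteristic_of_real if_P[OF True] by (simp only: mult_zero_right)
    qed simp
  next
    case False
    \<comment> \<open>Cramer's rule for \<open>P + Q = w\<close> and
      \<open>P * b 1 + Q * b 2 = 2 - 2 * Re (K n) * w\<close>. With signed squared amplitudes
      proportional to \<open>P\<close> and \<open>Q\<close> times the squared moduli of
      \<open>K n + b s\<close>, these are the imaginary and real parts of the characteristic
      equation divided by its factors \<open>K n + b s\<close>.\<close>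
    define P where "P n = (2 - 2 * Re (K n) * w - b 2 * w) / (b 1 - b 2)" for n
    define Q where "Q n = (2 - 2 * Re (K n) * w - b 1 * w) / (b 2 - b 1)" for n
    define c1 where "c1 n = P n * (cmod (K n + of_real (b 1)))\<^sup>2 / (b 1)\<^sup>2" for n
    define c2 where "c2 n = \<sigma> * Q n * (cmod (K n + of_real (b 2)))\<^sup>2 / (b 2)\<^sup>2" for n
    have P0: "(2 - 2 * \<kappa> * w - b 2 * w) / (b 1 - b 2) = p" and Q0: "(2 - 2 * \<kappa> * w - b 1 * w) / (b 2 - b 1) = q"
      using False pq' by (simp_all add: pq[symmetric] divide_eq_eq) (simp_all add: algebra_simps)
    have "P \<longlonglongrightarrow> p" "Q \<longlonglongrightarrow> q"
      unfolding P_def[abs_def] Q_def[abs_def] P0[symmetric] Q0[symmetric]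
      by (intro tendsto_intros Re; use False in simp)+
    then have "c1 \<longlonglongrightarrow> p * (cmod (of_real \<kappa> + of_real (b 1)))\<^sup>2 / (b 1)\<^sup>2"
      and "c2 \<longlonglongrightarrow> \<sigma> * q * (cmod (of_real \<kappa> + of_real (b 2)))\<^sup>2 / (b 2)\<^sup>2"
      unfolding c1_def[abs_def] c2_def[abs_def] by (intro tendsto_intros K; use nz in simp)+
    then have c1: "c1 \<longlonglongrightarrow> (a 1)\<^sup>2" and c2: "c2 \<longlonglongrightarrow> (a 2)\<^sup>2"
      unfolding pa qa by (simp_all flip: of_real_add)
    have factored: "(k * w - 2) * (k + \<beta>1) * (k + \<beta>2) + P * ((k + \<beta>1) * (kc + \<beta>1)) * (k + \<beta>2)
        + Q * ((k + \<beta>2) * (kc + \<beta>2)) * (k + \<beta>1) = 0"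
      if "P + Q = w" "P * \<beta>1 + Q * \<beta>2 = 2 - (k + kc) * w" for k kc w P Q \<beta>1 \<beta>2 :: complex
    proof -
      have "k * w - 2 + P * (kc + \<beta>1) + Q * (kc + \<beta>2) = 0"
        using that(2) by (simp add: that(1)[symmetric] algebra_simps)
      then have "(k + \<beta>1) * (k + \<beta>2) * (k * w - 2 + P * (kc + \<beta>1) + Q * (kc + \<beta>2)) = 0"
        by simp
      then show ?thesis by (simp add: algebra_simps)
    qed
    show ?thesis
    proof (rule soliton_data_of_squares[OF adm K nonreal tendsto_const c1 c2])
      fix n and \<alpha> :: "nat \<Rightarrow> real"
      assume \<alpha>: "(\<alpha> 1)\<^sup>2 = c1 n" "(\<alpha> 2)\<^sup>2 = c2 n"
      have PQ: "P n + Q n = w" "P n * b 1 + Q n * b 2 = 2 - 2 * Re (K n) * w"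
        using False by (simp_all add: P_def Q_def divide_simps) (simp_all add: algebra_simps)
      have PQ': "complex_of_real (P n) + of_real (Q n) = of_real w"
        "complex_of_real (P n) * of_real (b 1) + of_real (Q n) * of_real (b 2) = 2 - (K n + cnj (K n)) * of_real w"
        using PQ[THEN arg_cong[of _ _ complex_of_real]] K_cnj(2)[of n] by simp_all
      have "\<sigma> * \<sigma> = 1" using \<sigma> by auto
      then have "(\<alpha> 1)\<^sup>2 * (b 1)\<^sup>2 = P n * (cmod (K n + of_real (b 1)))\<^sup>2"
        "\<sigma> * (\<alpha> 2)\<^sup>2 * (b 2)\<^sup>2 = Q n * (cmod (K n + of_real (b 2)))\<^sup>2"
        unfolding \<alpha> c1_def c2_def using nz by (simp_all flip: mult.assoc)
      then have "of_real ((\<alpha> 1)\<^sup>2 * (b 1)\<^sup>2) = of_real (P n) * ((K n + of_real (b 1)) * (cnj (K n) + of_real (b 1)))"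
        "of_real (\<sigma> * (\<alpha> 2)\<^sup>2 * (b 2)\<^sup>2) = of_real (Q n) * ((K n + of_real (b 2)) * (cnj (K n) + of_real (b 2)))"
        using K_cnj(1)[of n] by (metis of_real_mult)+
      moreover have "(K n / of_real z - 2) = K n * of_real w - 2" by (simp add: w_def)
      moreover have "(K n * of_real w - 2) * (K n + of_real (b 1)) * (K n + of_real (b 2))
          + of_real (P n) * ((K n + of_real (b 1)) * (cnj (K n) + of_real (b 1))) * (K n + of_real (b 2))
          + of_real (Q n) * ((K n + of_real (b 2)) * (cnj (K n) + of_real (b 2))) * (K n + of_real (b 1)) = 0"
        by (rule factored[OF PQ'])
      ultimately show "poly (map_poly of_real (characteristic_poly \<sigma> \<alpha> b z)) (K n) = 0"
        unfolding poly_characteristic_of_real using False by (simp only: if_False)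
    next
      \<comment> \<open>Vacuous: for \<open>b 1 \<noteq> b 2\<close> admissibility excludes
        \<open>a 2 = 0\<close>.\<close>
      show "c2 n = 0" if "a 2 = 0" for n
        using adm that False by (simp add: admissible_def)
    qed
  qed
qed

section \<open>Intensity: peak values, travelling profile and absence of rogue waves\<close>

lemma cmod_rational_soliton:
  "(cmod (rational_soliton \<sigma> a b z \<kappa> s x t))\<^sup>2 = (a s)\<^sup>2
    * (1 + (((\<kappa> - b s) / (\<kappa> + b s))\<^sup>2 - 1)
        / ((2 * \<kappa> * (x + 1 / (b 1 * b 2 * z) * (\<kappa> - z + (b 1 + b 2) / 2) * t))\<^sup>2 + 1))"
proof -
  define y where "y = 2 * \<kappa> * (x + 1 / (b 1 * b 2 * z) * (\<kappa> - z + (b 1 + b 2) / 2) * t)"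
  define r where "r = (\<kappa> - b s) / (\<kappa> + b s)"
  have y1: "y\<^sup>2 + 1 \<noteq> 0" by (smt (verit) zero_le_power2)
  have "(cmod (rational_soliton \<sigma> a b z \<kappa> s x t))\<^sup>2 = (a s)\<^sup>2 * ((y\<^sup>2 + r\<^sup>2) / (y\<^sup>2 + 1))"
    unfolding rational_soliton_def Let_def y_def[symmetric] r_def[symmetric]
    by (simp add: norm_mult norm_divide power_mult_distrib power_divide cmod_power2)
  also have "(y\<^sup>2 + r\<^sup>2) / (y\<^sup>2 + 1) = 1 + (r\<^sup>2 - 1) / (y\<^sup>2 + 1)"
    using y1 by (simp add: field_simps)
  finally show ?thesis by (simp only: y_def r_def)
qed

text \<open>The extremum is attained where the affine argument vanishes. If \<open>A * c\<close> is
  nonzero, every other value lies strictly between it and the background \<open>A\<close>, which is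
  approached but not attained and so is no peak value.\<close>

lemma peak_values_rational_profile:
  fixes A c v \<kappa> :: real
  shows "peak_values (\<lambda>x t. A * (1 + c / ((2 * \<kappa> * (x + v * t))\<^sup>2 + 1))) = {A * (1 + c)}" (is "peak_values ?f = _")
proof (cases "A * c = 0")
  case True
  then have "?f = (\<lambda>x t. A * (1 + c))" by (intro ext) auto
  then show ?thesis by (auto simp: peak_values_def)
next
  case False
  have pos: "0 < (2 * \<kappa> * (x + v * t))\<^sup>2 + 1" for x t by (smt (verit) zero_le_power2)
  have f: "?f x t = A + A * c * (1 / ((2 * \<kappa> * (x + v * t))\<^sup>2 + 1))" for x t
    by (simp add: algebra_simps)
  have le1: "1 / ((2 * \<kappa> * (x + v * t))\<^sup>2 + 1) \<le> 1" for x t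
    using pos[of x t] by (simp add: divide_simps)
  have f0: "?f 0 0 = A * (1 + c)" by simp
  have "A * (1 + c) \<in> peak_values ?f"
  proof (cases "A * c > 0")
    case True
    have "?f x t \<le> A * (1 + c)" for x t
      using mult_left_mono[OF le1[of x t], of "A * c"] True unfolding f by (simp add: algebra_simps)
    then show ?thesis using f0 unfolding peak_values_def by blast
  next
    case False
    have "A * (1 + c) \<le> ?f x t" for x t
      using mult_left_mono_neg[OF le1[of x t], of "A * c"] False unfolding f by (simp add: algebra_simps)
    then show ?thesis using f0 unfolding peak_values_def by blast
  qed
  moreover have "w = A * (1 + c)" if w: "w \<in> peak_values ?f" for w
  proof (rule ccontr)
    assume neq: "w \<noteq> A * (1 + c)"
    obtain x t where xt: "?f x t = w" and ext: "(\<forall>x t. ?f x t \<le> w) \<or> (\<forall>x t. w \<le> ?f x t)"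
      using w unfolding peak_values_def by blast
    define y where "y = 2 * \<kappa> * (x + v * t)"
    have y: "y \<noteq> 0"
      using neq xt by (auto simp: y_def)
    have wy: "w = A + A * c * (1 / (y\<^sup>2 + 1))" using xt f y_def by simp
    \<comment> \<open>At the same time \<open>t\<close>, the point \<open>2 * x + v * t\<close> has
      twice the argument \<open>y\<close>. Its value is closer to the background, whereas the origin
      has the extremal value, so \<open>w\<close> lies strictly between two attained values.\<close>
    have "2 * \<kappa> * ((2 * x + v * t) + v * t) = 2 * y" by (simp add: y_def algebra_simps)
    then have f2: "?f (2 * x + v * t) t = A + A * c * (1 / ((2 * y)\<^sup>2 + 1))"
      unfolding f by (simp only:)
    have lt: "1 / ((2 * y)\<^sup>2 + 1) < 1 / (y\<^sup>2 + 1)" "1 / (y\<^sup>2 + 1) < 1"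
    proof -
      have "0 < y\<^sup>2" using y by simp
      moreover from this have "0 < y\<^sup>2 + 1" "0 < 4 * y\<^sup>2 + 1" by linarith+
      ultimately show "1 / ((2 * y)\<^sup>2 + 1) < 1 / (y\<^sup>2 + 1)" "1 / (y\<^sup>2 + 1) < 1"
        by (simp_all add: divide_simps power_mult_distrib)
    qed
    have "?f 0 0 = A + A * c * 1" by (simp add: algebra_simps)
    with ext f2 have ext': "(A * c * 1 \<le> A * c * (1 / (y\<^sup>2 + 1)) \<and> A * c * (1 / ((2 * y)\<^sup>2 + 1)) \<le> A * c * (1 / (y\<^sup>2 + 1)))
       \<or> (A * c * (1 / (y\<^sup>2 + 1)) \<le> A * c * 1 \<and> A * c * (1 / (y\<^sup>2 + 1)) \<le> A * c * (1 / ((2 * y)\<^sup>2 + 1)))"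
      unfolding wy by (metis add_le_cancel_left)
    show False
    proof (cases "A * c > 0")
      case True
      with ext' lt show False by (simp only: mult_le_cancel_left_pos not_le[symmetric]) blast
    next
      case neg: False
      then have "A * c < 0" using False by linarith
      with ext' lt show False by (simp only: mult_le_cancel_left_neg not_le[symmetric]) blast
    qed
  qed
  ultimately show ?thesis by blast
qed

lemma rational_profile_tendsto:
  fixes A c \<kappa> :: real
  assumes "\<kappa> \<noteq> 0"
  shows "((\<lambda>\<xi>. A * (1 + c / ((2 * \<kappa> * \<xi>)\<^sup>2 + 1))) \<longlongrightarrow> A) at_top"
    and "((\<lambda>\<xi>. A * (1 + c / ((2 * \<kappa> * \<xi>)\<^sup>2 + 1))) \<longlongrightarrow> A) at_bot"
  using assms by real_asymp+

text \<open>The difference of the squares is \<open>- 4 * \<kappa> * \<beta>\<close>. Thus the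
  intensity is flat only for \<open>\<kappa> = 0\<close>, apart from a zero amplitude.\<close>

lemma reflection_coefficient_square:
  fixes \<kappa> \<beta> :: real
  assumes "\<kappa> + \<beta> \<noteq> 0" "\<beta> \<noteq> 0"
  shows "((\<kappa> - \<beta>) / (\<kappa> + \<beta>))\<^sup>2 - 1 = 0 \<longleftrightarrow> \<kappa> = 0"
proof -
  have "((\<kappa> - \<beta>) / (\<kappa> + \<beta>))\<^sup>2 - 1 = ((\<kappa> - \<beta>)\<^sup>2 - (\<kappa> + \<beta>)\<^sup>2) / (\<kappa> + \<beta>)\<^sup>2"
    unfolding power_divide by (subst diff_divide_distrib) (use assms in simp)
  moreover have "(\<kappa> - \<beta>)\<^sup>2 - (\<kappa> + \<beta>)\<^sup>2 = - (4 * \<kappa> * \<beta>)"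
    by (simp add: power2_eq_square algebra_simps)
  ultimately show ?thesis using assms by simp
qed

lemma filterlim_line_at_infinity:
  "filterlim (\<lambda>\<tau>::real. (v * \<tau>, \<tau>)) at_infinity at_top"
  unfolding filterlim_at_infinity_conv_norm_at_top
  by (rule filterlim_at_top_mono[OF filterlim_ident])
    (auto intro!: always_eventually order_trans[OF _ norm_snd_le])

text \<open>The intensity depends on \<open>x\<close> and \<open>t\<close> only through the affine
  argument, whose slope does not involve \<open>s\<close>; both components therefore travel with the
  same velocity.\<close>

lemma soliton_profile_rational_soliton:
  assumes "\<kappa> \<noteq> 0" "a s \<noteq> 0" "\<kappa> + b s \<noteq> 0" "b s \<noteq> 0"
  shows "soliton_profile (- (1 / (b 1 * b 2 * z) * (\<kappa> - z + (b 1 + b 2) / 2))) (a s) (rational_soliton \<sigma> a b z \<kappa> s)"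
proof -
  define c where "c = ((\<kappa> - b s) / (\<kappa> + b s))\<^sup>2 - 1"
  have c: "c \<noteq> 0"
    unfolding c_def using reflection_coefficient_square assms by metis
  show ?thesis
    unfolding soliton_profile_def
  proof (intro exI[of _ "\<lambda>\<xi>. (a s)\<^sup>2 * (1 + c / ((2 * \<kappa> * \<xi>)\<^sup>2 + 1))"] conjI allI exI[of _ 0])
    show "(a s)\<^sup>2 * (1 + c / ((2 * \<kappa> * 0)\<^sup>2 + 1)) \<noteq> (a s)\<^sup>2"
      using c assms by simp
  qed (simp_all only: cmod_rational_soliton c_def rational_profile_tendsto[OF assms(1)] mult_minus_left diff_minus_eq_add)
qed

lemma not_rogue_wave_rational_soliton:
  "\<not> rogue_wave_profile (a s) (rational_soliton \<sigma> a b z \<kappa> s)" if nz: "\<kappa> + b s \<noteq> 0" "b s \<noteq> 0"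
proof
  define v where "v = 1 / (b 1 * b 2 * z) * (\<kappa> - z + (b 1 + b 2) / 2)"
  define c where "c = ((\<kappa> - b s) / (\<kappa> + b s))\<^sup>2 - 1"
  have sq: "(cmod (rational_soliton \<sigma> a b z \<kappa> s x t))\<^sup>2 = (a s)\<^sup>2 * (1 + c / ((2 * \<kappa> * (x + v * t))\<^sup>2 + 1))" for x t
    by (simp only: cmod_rational_soliton v_def c_def)
  assume "rogue_wave_profile (a s) (rational_soliton \<sigma> a b z \<kappa> s)"
  then obtain x t where xt: "cmod (rational_soliton \<sigma> a b z \<kappa> s x t) \<noteq> \<bar>a s\<bar>"
    and lim: "((\<lambda>(x, t). cmod (rational_soliton \<sigma> a b z \<kappa> s x t)) \<longlongrightarrow> \<bar>a s\<bar>) at_infinity"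
    by (auto simp: rogue_wave_profile_def)
  have "(cmod (rational_soliton \<sigma> a b z \<kappa> s x t))\<^sup>2 \<noteq> (a s)\<^sup>2"
    using xt by (metis abs_norm_cancel power2_eq_iff_nonneg abs_ge_zero norm_ge_zero power2_abs)
  \<comment> \<open>The nontriviality clause of a rogue wave rules out a flat intensity, so the
    constant value along the crest differs from the background.\<close>
  then have nontrivial: "c \<noteq> 0" "a s \<noteq> 0"
    unfolding sq by auto
  have "((\<lambda>\<tau>. cmod (rational_soliton \<sigma> a b z \<kappa> s (- v * \<tau>) \<tau>)) \<longlongrightarrow> \<bar>a s\<bar>) at_top"
    using filterlim_compose[OF lim filterlim_line_at_infinity[of "- v"]] by simp
  from tendsto_power[OF this, of 2]
  have "((\<lambda>\<tau>::real. (a s)\<^sup>2 * (1 + c)) \<longlongrightarrow> (a s)\<^sup>2) at_top"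
    unfolding sq by simp
  then have "(a s)\<^sup>2 * (1 + c) = (a s)\<^sup>2"
    by (simp add: tendsto_const_iff)
  with nontrivial show False by simp
qed

text \<open>At a double root 0 the formula collapses to the plane wave
  \<open>- a s * exp (\<i> * phase)\<close>, which has no nontrivial profile, and the limit of the
  dark soliton depends on the direction in which the roots tend to 0. Hence the soliton claim and
  the limit along arbitrary data are stated for a nonzero root, while suitable data with the right
  limit are provided in every case.\<close>

theorem mainTheorem10:
  fixes \<sigma> z\<^sub>1 \<kappa>\<^sub>1 :: real and a b :: "nat \<Rightarrow> real"
  assumes "\<sigma> = 1 \<or> \<sigma> = -1"
    and "admissible a b z\<^sub>1"
    and "order \<kappa>\<^sub>1 (characteristic_poly \<sigma> a b z\<^sub>1) \<ge> 2"
    and "\<kappa>\<^sub>1 + b 1 \<noteq> 0" and "\<kappa>\<^sub>1 + b 2 \<noteq> 0"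
  shows "coupled_FL_solution \<sigma> (rational_soliton \<sigma> a b z\<^sub>1 \<kappa>\<^sub>1)
    \<and> (\<exists>\<epsilon>\<^sub>1\<in>{1, -1::real}.
        (\<exists>A B Z K. soliton_data_tendsto \<sigma> A B Z K a b z\<^sub>1 \<kappa>\<^sub>1 \<and>
          (\<forall>s\<in>{1,2}. \<forall>x t. (\<lambda>n. dark_soliton \<sigma> (A n) (B n) (Z n) \<epsilon>\<^sub>1 (K n) s x t)
            \<longlonglongrightarrow> rational_soliton \<sigma> a b z\<^sub>1 \<kappa>\<^sub>1 s x t)) \<and>
        (\<kappa>\<^sub>1 \<noteq> 0 \<longrightarrow> (\<forall>A B Z K. soliton_data_tendsto \<sigma> A B Z K a b z\<^sub>1 \<kappa>\<^sub>1 \<longrightarrow>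
          (\<forall>s\<in>{1,2}. \<forall>x t. (\<lambda>n. dark_soliton \<sigma> (A n) (B n) (Z n) \<epsilon>\<^sub>1 (K n) s x t)
            \<longlonglongrightarrow> rational_soliton \<sigma> a b z\<^sub>1 \<kappa>\<^sub>1 s x t))))
    \<and> (\<forall>s\<in>{1,2}. peak_values (\<lambda>x t. (cmod (rational_soliton \<sigma> a b z\<^sub>1 \<kappa>\<^sub>1 s x t))\<^sup>2)
        = {(a s)\<^sup>2 * ((\<kappa>\<^sub>1 - b s)\<^sup>2 / (\<kappa>\<^sub>1 + b s)\<^sup>2)})
    \<and> (\<kappa>\<^sub>1 \<noteq> 0 \<longrightarrow> (\<exists>v. \<forall>s\<in>{1,2}. a s \<noteq> 0 \<longrightarrow>
        soliton_profile v (a s) (rational_soliton \<sigma> a b z\<^sub>1 \<kappa>\<^sub>1 s)))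
    \<and> (\<forall>s\<in>{1,2}. \<not> rogue_wave_profile (a s) (rational_soliton \<sigma> a b z\<^sub>1 \<kappa>\<^sub>1 s))"
proof -
  note roots = double_root_identities[OF assms(2-5)]
  have nz: "z\<^sub>1 \<noteq> 0" "b 1 \<noteq> 0" "b 2 \<noteq> 0" "\<kappa>\<^sub>1 + b 1 \<noteq> 0" "\<kappa>\<^sub>1 + b 2 \<noteq> 0"
    using assms(2,4,5) by (auto simp: admissible_def spectral_value_iff)
  have nzs: "b s \<noteq> 0" "\<kappa>\<^sub>1 + b s \<noteq> 0" if "s \<in> {1, 2}" for s
    using that nz by auto
  have lim: "(\<lambda>n. dark_soliton \<sigma> (A n) (B n) (Z n) \<epsilon> (K n) s x t) \<longlonglongrightarrow> rational_soliton \<sigma> a b z\<^sub>1 \<kappa>\<^sub>1 s x t"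
    if "soliton_data_tendsto \<sigma> A B Z K a b z\<^sub>1 \<kappa>\<^sub>1" "s \<in> {1, 2}"
      and "(\<lambda>n. (Re (K n) + \<epsilon> * cmod (K n)) / Im (K n)) \<longlonglongrightarrow> 0"
    for A B Z K \<epsilon> s x t
    by (rule dark_soliton_tendsto_rational_soliton[OF that(2) _ _ _ _ _ that(3) nz])
      (use that(1) in \<open>auto simp: soliton_data_tendsto_def\<close>)
  have degeneration: "\<exists>\<epsilon>\<^sub>1\<in>{1, -1::real}.
        (\<exists>A B Z K. soliton_data_tendsto \<sigma> A B Z K a b z\<^sub>1 \<kappa>\<^sub>1 \<and>
          (\<forall>s\<in>{1,2}. \<forall>x t. (\<lambda>n. dark_soliton \<sigma> (A n) (B n) (Z n) \<epsilon>\<^sub>1 (K n) s x t)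
            \<longlonglongrightarrow> rational_soliton \<sigma> a b z\<^sub>1 \<kappa>\<^sub>1 s x t)) \<and>
        (\<kappa>\<^sub>1 \<noteq> 0 \<longrightarrow> (\<forall>A B Z K. soliton_data_tendsto \<sigma> A B Z K a b z\<^sub>1 \<kappa>\<^sub>1 \<longrightarrow>
          (\<forall>s\<in>{1,2}. \<forall>x t. (\<lambda>n. dark_soliton \<sigma> (A n) (B n) (Z n) \<epsilon>\<^sub>1 (K n) s x t)
            \<longlonglongrightarrow> rational_soliton \<sigma> a b z\<^sub>1 \<kappa>\<^sub>1 s x t)))"
  proof -
    \<comment> \<open>At 0 the function \<open>sgn\<close> vanishes and yields no admissible sign;
      -1 is opposite to the positive real parts of the sequence \<open>K\<close> chosen
      next.\<close>
    define \<epsilon> where "\<epsilon> = (if \<kappa>\<^sub>1 = 0 then - 1 else - sgn \<kappa>\<^sub>1)"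
    define K where "K n = Complex (\<kappa>\<^sub>1 + inverse (real (Suc n))) ((inverse (real (Suc n)))\<^sup>2)" for n
    have \<epsilon>: "\<epsilon> \<in> {1, -1}" by (auto simp: \<epsilon>_def sgn_if)
    have sgn: "(\<lambda>n. (Re (K n) + \<epsilon> * cmod (K n)) / Im (K n)) \<longlonglongrightarrow> 0"
      if "K \<longlonglongrightarrow> of_real \<kappa>\<^sub>1" "\<And>n. K n \<notin> \<real>" "\<kappa>\<^sub>1 \<noteq> 0" for K
      using sign_quotient_tendsto_0[OF that(1,3,2)] that(3) by (simp add: \<epsilon>_def)
    have "(\<lambda>n. Complex (\<kappa>\<^sub>1 + inverse (real (Suc n))) ((inverse (real (Suc n)))\<^sup>2)) \<longlonglongrightarrow> Complex (\<kappa>\<^sub>1 + 0) (0\<^sup>2)"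
      by (intro tendsto_intros LIMSEQ_inverse_real_of_nat)
    then have Klim: "K \<longlonglongrightarrow> of_real \<kappa>\<^sub>1"
      by (simp add: K_def[abs_def] complex_of_real_def)
    have nonreal: "K n \<notin> \<real>" for n
      by (simp add: K_def complex_is_Real_iff)
    \<comment> \<open>For \<open>\<kappa>\<^sub>1 = 0\<close> the choice of \<open>K\<close> matters: it approaches \<open>0\<close> tangentially to the positive real axis.\<close>
    have K_sgn: "(\<lambda>n. (Re (K n) + \<epsilon> * cmod (K n)) / Im (K n)) \<longlonglongrightarrow> 0"
    proof (cases "\<kappa>\<^sub>1 = 0")
      case True
      have "norm ((Re (K n) + \<epsilon> * cmod (K n)) / Im (K n)) \<le> inverse (real (Suc n))" for n
      proof -
        define d where "d = inverse (real (Suc n))"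
        have d: "d > 0" by (simp add: d_def)
        have K: "Re (K n) = d" "Im (K n) = d\<^sup>2" using True by (simp_all add: K_def d_def)
        have "Re (K n) - \<epsilon> * cmod (K n) \<ge> d" using True K by (simp add: \<epsilon>_def)
        moreover have "(Re (K n) + \<epsilon> * cmod (K n)) / Im (K n) = - Im (K n) / (Re (K n) - \<epsilon> * cmod (K n))"
          using calculation d K \<epsilon> by (intro sign_quotient_eq) auto
        ultimately have "norm ((Re (K n) + \<epsilon> * cmod (K n)) / Im (K n)) \<le> d\<^sup>2 / d"
          using d K by (simp add: abs_divide) (intro divide_left_mono, auto)
        with d show ?thesis by (simp add: d_def power2_eq_square)
      qed
      then show ?thesis
        by (intro Lim_null_comparison[OF _ LIMSEQ_inverse_real_of_nat] always_eventually) auto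
    qed (rule sgn[OF Klim nonreal])
    obtain N A B Z where data: "soliton_data_tendsto \<sigma> A B Z (\<lambda>n. K (n + N)) a b z\<^sub>1 \<kappa>\<^sub>1"
      using soliton_data_exist[OF assms(1,2) nz(4,5) roots Klim nonreal] by blast
    have K_lim: "\<forall>s\<in>{1,2}. \<forall>x t. (\<lambda>n. dark_soliton \<sigma> (A n) (B n) (Z n) \<epsilon> (K (n + N)) s x t)
        \<longlonglongrightarrow> rational_soliton \<sigma> a b z\<^sub>1 \<kappa>\<^sub>1 s x t"
      using lim[OF data _ LIMSEQ_ignore_initial_segment[OF K_sgn]] by blast
    have "\<forall>s\<in>{1,2}. \<forall>x t. (\<lambda>n. dark_soliton \<sigma> (A n) (B n) (Z n) \<epsilon> (K n) s x t)
        \<longlonglongrightarrow> rational_soliton \<sigma> a b z\<^sub>1 \<kappa>\<^sub>1 s x t"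
      if "\<kappa>\<^sub>1 \<noteq> 0" and data: "soliton_data_tendsto \<sigma> A B Z K a b z\<^sub>1 \<kappa>\<^sub>1" for A B Z K
      using data that(1) by (intro ballI allI lim[OF data _ sgn]) (auto simp: soliton_data_tendsto_def)
    then show ?thesis
      by (intro bexI[OF _ \<epsilon>] conjI exI impI allI) (rule data, rule K_lim, blast)
  qed
  have peak: "peak_values (\<lambda>x t. (cmod (rational_soliton \<sigma> a b z\<^sub>1 \<kappa>\<^sub>1 s x t))\<^sup>2)
      = {(a s)\<^sup>2 * ((\<kappa>\<^sub>1 - b s)\<^sup>2 / (\<kappa>\<^sub>1 + b s)\<^sup>2)}" for s
    unfolding cmod_rational_soliton peak_values_rational_profile by (simp add: power_divide)
  have soliton: "\<exists>v. \<forall>s\<in>{1,2}. a s \<noteq> 0 \<longrightarrow> soliton_profile v (a s) (rational_soliton \<sigma> a b z\<^sub>1 \<kappa>\<^sub>1 s)"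
    if "\<kappa>\<^sub>1 \<noteq> 0"
    by (rule exI, intro ballI impI, rule soliton_profile_rational_soliton[OF that _ nzs(2,1)])
  show ?thesis
  proof (intro conjI impI ballI)
    show "\<not> rogue_wave_profile (a s) (rational_soliton \<sigma> a b z\<^sub>1 \<kappa>\<^sub>1 s)" if "s \<in> {1, 2}" for s
      using that by (intro not_rogue_wave_rational_soliton nzs)
  qed (rule coupled_FL_solution_rational_soliton[OF nz roots] degeneration peak soliton, assumption?)+
qed

end
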